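(* Let $\alpha$ be a positive root of $\Phi$ and let $P$ be the directed graph of stretching classes constructed from $\alpha$ (as in the context). Let $n_0$ be the smallest value such that every stretching class in $P$ with a single asterisk has an element defined on $\mathrm{st}_{n_0}(G)$. Then for all $n\ge n_0+1$, $$\{\beta\in\mathrm{st}_n(\Phi)^+ : \beta\le\mathrm{st}_n(\alpha)\}=\bigcup_{\overline{\beta}\in P}\overline{\beta}[n],$$ where $\le$ is the root poset of $\mathrm{st}_n(\Phi)$.
   Context: $\Phi$ is the root system of a crystallographic Cartan matrix $A$ for a Coxeter group with diagram $G$ (simple roots $\alpha_i$ indexed by vertices, $s_i(\beta)=\beta-(\alpha_i,\beta)\alpha_i$ with $(\alpha_i,\alpha_j)=A_{ij}$, $\Phi$ the union of $W$-orbits of simple roots); roots are identified with integer-valued functions on vertices. Depth of a positive root: $1+$ the minimal $\ell$ in an expression $s_{y_\ell}\cdots s_{y_1}(\alpha_{y_0})$. Root poset: $\beta\le\gamma$ iff $\gamma=s_{i_k}\cdots s_{i_1}(\beta)$ with depth increasing by exactly $1$ at each step. Elastic data $(x,L_x,R_x)$: a vertex $x$ and partition of its neighbors. $\mathrm{st}_m(G)$ replaces $x$ by a path $x_0-\cdots-x_m$ of unlabeled edges with $x_0$ joined to $L_x$, $x_m$ joined to $R_x$ by the original labeled edges; $\mathrm{st}_m(A)$ has entries $A_{yz}$ off the path, $A_{xz}$ at $(x_0,z)$ for $z\in L_x$ and at $(x_m,z)$ for $z\in R_x$, $A_{yx}$ at $(y,x_0)$ for $y\in L_x$ and at $(y,x_m)$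 for $y\in R_x$, $2$ at $(x_i,x_i)$, $-1$ at $(x_i,x_{i\pm1})$, $0$ otherwise; $\mathrm{st}_m(\Phi)$ is its root system; $\mathrm{st}_0(G)=G$. $\mathrm{st}_n(\alpha)$ takes value $\alpha(x)$ at all $x_i$ and agrees with $\alpha$ elsewhere. Stretching class: given an integer-valued function $b$ on the vertices of some $\mathrm{st}_m(G)$ and a marking (asterisks) of consecutive path vertices $x_p,\dots,x_q$ ($0\le p\le q\le m$) with $b(x_j)\ne b(x_{j+1})$ for $p\le j<q$, the class $\overline{b}$ consists of all functions on vertices of $\mathrm{st}_n(G)$ (any $n$) agreeing with $b$ off the path, with values $b(x_0),\dots,b(x_{p-1})$ on $x_0,\dots,x_{p-1}$, values $b(x_{q+1}),\dots,b(x_m)$ on the last $m-q$ path vertices, and on the remaining path vertices the values $b(x_p),\dots,b(x_q)$ in this order, each repeated a positive number of times. $\overline{b}[n]$ is the set of its elements on $\mathrm{st}_n(G)$. Left endpoint $x_p$, right endpoint $x_q$, internal vertices $x_{p+1},\dots,x_{q-1}$. Class left neighbors: $L_x$ if $p=0$, else $\{x_{p-1}\}$; class right neighbors: $R_x$ if $q=m$, else $\{x_{q+1}\}$. Weighted left sum $S_L=\sum_y-\mathrm{st}_m(A)_{x_p y}b(y)$ over class left neighbors; weighted right sum $S_R$ analogously at $x_q$. Reflecting at $z$ replaces $b(z)$ by $\sum_{y\text{ adj. }z}-\mathrm{st}_m(A)_{zy}b(y)-b(z)$, keeping marks. Operations: (1) reflect at an unmarked vertex where this decreases the value; (2) reflect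 at an internal vertex where this decreases the value; (3) if $S_L<b(x_p)$, insert a new marked vertex with value $S_L$ immediately left of $x_p$ (passing to $\mathrm{st}_{m+1}(G)$), symmetrically on the right if $S_R<b(x_q)$; (4) if $q>p$, reflect at $x_p$ when this decreases its value, removing its mark if the new value is $\ge b(x_{p+1})$; symmetrically at $x_q$. $P$ is the directed graph whose vertices form the smallest set of such marked functions containing $\alpha^*$ ($\alpha$ on $G$ with $x_0=x$ marked) and closed under these operations, with arrows from each to the results of operations on it, results with a negative value being discarded. A class in $P$ "with a single asterisk" defined by $b$ on $\mathrm{st}_m(G)$ has elements exactly on $\mathrm{st}_n(G)$ for $n\ge m$. *)

theory Defs
  imports Complex_Main "HOL-Library.Extended_Nat"
begin

section \<open>Coxeter diagrams, Cartan matrices and root systems\<close>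

text \<open>
  A Coxeter diagram is stored as its vertex set with the Coxeter matrix \<open>label\<close>: the value
  \<open>2\<close> means that there is no edge, \<open>3\<close> is an unlabeled edge.  Integer-valued functions on the
  vertices are represented by functions on the whole type that vanish outside \<open>verts G\<close>.
\<close>

record 'v diagram =
  verts :: "'v set"
  label :: "'v \<Rightarrow> 'v \<Rightarrow> enat"

definition coxeter_diagram :: "'v diagram \<Rightarrow> bool" where
  "coxeter_diagram G \<longleftrightarrow> finite (verts G) \<and>
     (\<forall>i\<in>verts G. label G i i = 1) \<and>
     (\<forall>i\<in>verts G. \<forall>j\<in>verts G. i \<noteq> j \<longrightarrow> label G i j \<ge> 2 \<and> label G i j = label G j i)"

definition neighbors :: "'v diagram \<Rightarrow> 'v \<Rightarrow> 'v set" where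
  "neighbors G v = {w \<in> verts G. w \<noteq> v \<and> label G v w \<noteq> 2}"

definition crystallographic_cartan :: "'v diagram \<Rightarrow> ('v \<Rightarrow> 'v \<Rightarrow> int) \<Rightarrow> bool" where
  "crystallographic_cartan G A \<longleftrightarrow>
     (\<forall>i\<in>verts G. A i i = 2) \<and>
     (\<forall>i\<in>verts G. \<forall>j\<in>verts G. i \<noteq> j \<longrightarrow>
        A i j \<le> 0 \<and> (A i j = 0 \<longleftrightarrow> A j i = 0) \<and>
        (case label G i j of
           enat m \<Rightarrow> real_of_int (A i j * A j i) = 4 * (cos (pi / real m))\<^sup>2
         | \<infinity> \<Rightarrow> A i j * A j i \<ge> 4))"

definition simple_root :: "'v \<Rightarrow> 'v \<Rightarrow> int" where
  "simple_root i = (\<lambda>j. if j = i then 1 else 0)"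

definition cartan_form :: "'v diagram \<Rightarrow> ('v \<Rightarrow> 'v \<Rightarrow> int) \<Rightarrow> ('v \<Rightarrow> int) \<Rightarrow> ('v \<Rightarrow> int) \<Rightarrow> int" where
  "cartan_form G A \<beta> \<gamma> = (\<Sum>i\<in>verts G. \<Sum>j\<in>verts G. \<beta> i * A i j * \<gamma> j)"

definition simple_refl :: "'v diagram \<Rightarrow> ('v \<Rightarrow> 'v \<Rightarrow> int) \<Rightarrow> 'v \<Rightarrow> ('v \<Rightarrow> int) \<Rightarrow> ('v \<Rightarrow> int)" where
  "simple_refl G A i \<beta> = (\<lambda>j. \<beta> j - cartan_form G A (simple_root i) \<beta> * simple_root i j)"

definition is_expression ::
    "'v diagram \<Rightarrow> ('v \<Rightarrow> 'v \<Rightarrow> int) \<Rightarrow> ('v \<Rightarrow> int) \<Rightarrow> 'v list \<Rightarrow> 'v \<Rightarrow> bool" where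
  "is_expression G A \<beta> w y \<longleftrightarrow>
     set w \<subseteq> verts G \<and> y \<in> verts G \<and> \<beta> = foldr (simple_refl G A) w (simple_root y)"

definition root_system :: "'v diagram \<Rightarrow> ('v \<Rightarrow> 'v \<Rightarrow> int) \<Rightarrow> ('v \<Rightarrow> int) set" where
  "root_system G A = {\<beta>. \<exists>w y. is_expression G A \<beta> w y}"

definition pos_roots :: "'v diagram \<Rightarrow> ('v \<Rightarrow> 'v \<Rightarrow> int) \<Rightarrow> ('v \<Rightarrow> int) set" where
  "pos_roots G A = {\<beta> \<in> root_system G A. \<forall>v\<in>verts G. 0 \<le> \<beta> v}"

definition depth :: "'v diagram \<Rightarrow> ('v \<Rightarrow> 'v \<Rightarrow> int) \<Rightarrow> ('v \<Rightarrow> int) \<Rightarrow> nat" where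
  "depth G A \<beta> = 1 + (LEAST l. \<exists>w y. is_expression G A \<beta> w y \<and> length w = l)"

definition root_step ::
    "'v diagram \<Rightarrow> ('v \<Rightarrow> 'v \<Rightarrow> int) \<Rightarrow> ('v \<Rightarrow> int) \<Rightarrow> ('v \<Rightarrow> int) \<Rightarrow> bool" where
  "root_step G A \<beta> \<gamma> \<longleftrightarrow> \<beta> \<in> pos_roots G A \<and> \<gamma> \<in> pos_roots G A \<and>
     (\<exists>i\<in>verts G. \<gamma> = simple_refl G A i \<beta>) \<and> depth G A \<gamma> = depth G A \<beta> + 1"

definition root_le ::
    "'v diagram \<Rightarrow> ('v \<Rightarrow> 'v \<Rightarrow> int) \<Rightarrow> ('v \<Rightarrow> int) \<Rightarrow> ('v \<Rightarrow> int) \<Rightarrow> bool" where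
  "root_le G A \<beta> \<gamma> \<longleftrightarrow>
     \<beta> \<in> pos_roots G A \<and> \<gamma> \<in> pos_roots G A \<and> (root_step G A)\<^sup>*\<^sup>* \<beta> \<gamma>"


section \<open>Stretching\<close>

definition elastic_data :: "'v diagram \<Rightarrow> 'v \<Rightarrow> 'v set \<Rightarrow> 'v set \<Rightarrow> bool" where
  "elastic_data G x L R \<longleftrightarrow> x \<in> verts G \<and> L \<union> R = neighbors G x \<and> L \<inter> R = {}"

text \<open>\<open>Off v\<close> is a vertex \<open>v \<noteq> x\<close> of the original diagram, \<open>Path i\<close> is the path vertex \<open>x\<^sub>i\<close>;
  for \<open>m = 0\<close> the vertex \<open>Path 0\<close> plays the role of \<open>x\<close>.\<close>

datatype 'v svert = Off 'v | Path nat

fun st_label ::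
    "('v \<Rightarrow> 'v \<Rightarrow> enat) \<Rightarrow> 'v \<Rightarrow> 'v set \<Rightarrow> 'v set \<Rightarrow> nat \<Rightarrow> 'v svert \<Rightarrow> 'v svert \<Rightarrow> enat" where
  "st_label M x L R m (Off y) (Off z) = M y z"
| "st_label M x L R m (Path i) (Off z) = (if i = 0 \<and> z \<in> L \<or> i = m \<and> z \<in> R then M x z else 2)"
| "st_label M x L R m (Off y) (Path i) = (if i = 0 \<and> y \<in> L \<or> i = m \<and> y \<in> R then M y x else 2)"
| "st_label M x L R m (Path i) (Path j) =
     (if i = j then 1 else if i = Suc j \<or> j = Suc i then 3 else 2)"

definition st_diagram :: "'v diagram \<Rightarrow> 'v \<Rightarrow> 'v set \<Rightarrow> 'v set \<Rightarrow> nat \<Rightarrow> 'v svert diagram" where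
  "st_diagram G x L R m =
     \<lparr>verts = Off ` (verts G - {x}) \<union> Path ` {0..m}, label = st_label (label G) x L R m\<rparr>"

fun st_cartan ::
    "('v \<Rightarrow> 'v \<Rightarrow> int) \<Rightarrow> 'v \<Rightarrow> 'v set \<Rightarrow> 'v set \<Rightarrow> nat \<Rightarrow> 'v svert \<Rightarrow> 'v svert \<Rightarrow> int" where
  "st_cartan A x L R m (Off y) (Off z) = A y z"
| "st_cartan A x L R m (Path i) (Off z) = (if i = 0 \<and> z \<in> L \<or> i = m \<and> z \<in> R then A x z else 0)"
| "st_cartan A x L R m (Off y) (Path i) = (if i = 0 \<and> y \<in> L \<or> i = m \<and> y \<in> R then A y x else 0)"
| "st_cartan A x L R m (Path i) (Path j) =
     (if i = j then 2 else if i = Suc j \<or> j = Suc i then - 1 else 0)"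

fun st_fun :: "'v \<Rightarrow> nat \<Rightarrow> ('v \<Rightarrow> int) \<Rightarrow> 'v svert \<Rightarrow> int" where
  "st_fun x n \<alpha> (Off v) = (if v = x then 0 else \<alpha> v)"
| "st_fun x n \<alpha> (Path i) = (if i \<le> n then \<alpha> x else 0)"


section \<open>Stretching classes\<close>

text \<open>\<open>(m, b, p, q)\<close> is the function \<open>b\<close> on the vertices of \<open>st\<^sub>m(G)\<close> with \<open>x\<^sub>p, \<dots>, x\<^sub>q\<close> marked.\<close>

type_synonym 'v marked = "nat \<times> ('v svert \<Rightarrow> int) \<times> nat \<times> nat"

text \<open>The set of elements on \<open>st\<^sub>n(G)\<close>; \<open>k j\<close> is the number of repetitions of \<open>b(x\<^sub>j)\<close>.\<close>

fun stretching_class :: "'v marked \<Rightarrow> nat \<Rightarrow> ('v svert \<Rightarrow> int) set" where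
  "stretching_class (m, b, p, q) n =
     {f. (\<forall>v. f (Off v) = b (Off v)) \<and> (\<forall>i>n. f (Path i) = 0) \<and>
         (\<exists>k. (\<forall>j\<in>{p..q}. 0 < k j) \<and>
            map (\<lambda>i. f (Path i)) [0..<Suc n] =
              map (\<lambda>i. b (Path i)) [0..<p] @
              concat (map (\<lambda>j. replicate (k j) (b (Path j))) [p..<Suc q]) @
              map (\<lambda>i. b (Path i)) [Suc q..<Suc m])}"

fun single_asterisk :: "'v marked \<Rightarrow> bool" where
  "single_asterisk (m, b, p, q) \<longleftrightarrow> p = q"

definition class_left :: "'v set \<Rightarrow> nat \<Rightarrow> 'v svert set" where
  "class_left L p = (if p = 0 then Off ` L else {Path (p - 1)})"

definition class_right :: "'v set \<Rightarrow> nat \<Rightarrow> nat \<Rightarrow> 'v svert set" where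
  "class_right R m q = (if q = m then Off ` R else {Path (q + 1)})"

definition left_sum :: "('v \<Rightarrow> 'v \<Rightarrow> int) \<Rightarrow> 'v \<Rightarrow> 'v set \<Rightarrow> 'v set \<Rightarrow> nat \<Rightarrow> ('v svert \<Rightarrow> int) \<Rightarrow> nat \<Rightarrow> int" where
  "left_sum A x L R m b p = (\<Sum>y\<in>class_left L p. - st_cartan A x L R m (Path p) y * b y)"

definition right_sum :: "('v \<Rightarrow> 'v \<Rightarrow> int) \<Rightarrow> 'v \<Rightarrow> 'v set \<Rightarrow> 'v set \<Rightarrow> nat \<Rightarrow> ('v svert \<Rightarrow> int) \<Rightarrow> nat \<Rightarrow> int" where
  "right_sum A x L R m b q = (\<Sum>y\<in>class_right R m q. - st_cartan A x L R m (Path q) y * b y)"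

definition reflected_value :: "'v diagram \<Rightarrow> ('v \<Rightarrow> 'v \<Rightarrow> int) \<Rightarrow> 'v \<Rightarrow> 'v set \<Rightarrow> 'v set \<Rightarrow> nat \<Rightarrow>
    ('v svert \<Rightarrow> int) \<Rightarrow> 'v svert \<Rightarrow> int" where
  "reflected_value G A x L R m b z =
     (\<Sum>y\<in>neighbors (st_diagram G x L R m) z. - st_cartan A x L R m z y * b y) - b z"

text \<open>The new path vertex with value \<open>c\<close> receives index \<open>k\<close>; later path vertices move up by one.\<close>

fun insert_path :: "nat \<Rightarrow> int \<Rightarrow> ('v svert \<Rightarrow> int) \<Rightarrow> 'v svert \<Rightarrow> int" where
  "insert_path k c b (Off v) = b (Off v)"
| "insert_path k c b (Path i) =
     (if i < k then b (Path i) else if i = k then c else b (Path (i - 1)))"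

inductive class_op :: "'v diagram \<Rightarrow> ('v \<Rightarrow> 'v \<Rightarrow> int) \<Rightarrow> 'v \<Rightarrow> 'v set \<Rightarrow> 'v set \<Rightarrow>
    'v marked \<Rightarrow> 'v marked \<Rightarrow> bool"
  for G A x L R where
  unmarked: "\<lbrakk>z \<in> verts (st_diagram G x L R m); z \<notin> Path ` {p..q};
      c = reflected_value G A x L R m b z; c < b z\<rbrakk>
    \<Longrightarrow> class_op G A x L R (m, b, p, q) (m, b(z := c), p, q)"
| internal: "\<lbrakk>p < j; j < q; c = reflected_value G A x L R m b (Path j); c < b (Path j)\<rbrakk>
    \<Longrightarrow> class_op G A x L R (m, b, p, q) (m, b(Path j := c), p, q)"
| insert_left: "\<lbrakk>c = left_sum A x L R m b p; c < b (Path p)\<rbrakk>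
    \<Longrightarrow> class_op G A x L R (m, b, p, q) (Suc m, insert_path p c b, p, Suc q)"
| insert_right: "\<lbrakk>c = right_sum A x L R m b q; c < b (Path q)\<rbrakk>
    \<Longrightarrow> class_op G A x L R (m, b, p, q) (Suc m, insert_path (Suc q) c b, p, Suc q)"
| left_endpoint: "\<lbrakk>p < q; c = reflected_value G A x L R m b (Path p); c < b (Path p)\<rbrakk>
    \<Longrightarrow> class_op G A x L R (m, b, p, q)
          (m, b(Path p := c), if c \<ge> b (Path (p + 1)) then p + 1 else p, q)"
| right_endpoint: "\<lbrakk>p < q; c = reflected_value G A x L R m b (Path q); c < b (Path q)\<rbrakk>
    \<Longrightarrow> class_op G A x L R (m, b, p, q)
          (m, b(Path q := c), p, if c \<ge> b (Path (q - 1)) then q - 1 else q)"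

fun nonneg_marked :: "'v diagram \<Rightarrow> 'v \<Rightarrow> 'v set \<Rightarrow> 'v set \<Rightarrow> 'v marked \<Rightarrow> bool" where
  "nonneg_marked G x L R (m, b, p, q) \<longleftrightarrow> (\<forall>v\<in>verts (st_diagram G x L R m). 0 \<le> b v)"

text \<open>The vertices of the directed graph \<open>P\<close>; its arrows are the instances of \<open>class_op\<close>
  between them.\<close>

inductive_set class_graph :: "'v diagram \<Rightarrow> ('v \<Rightarrow> 'v \<Rightarrow> int) \<Rightarrow> 'v \<Rightarrow> 'v set \<Rightarrow> 'v set \<Rightarrow>
    ('v \<Rightarrow> int) \<Rightarrow> 'v marked set"
  for G A x L R \<alpha> where
  start: "(0, st_fun x 0 \<alpha>, 0, 0) \<in> class_graph G A x L R \<alpha>"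
| step: "\<lbrakk>c \<in> class_graph G A x L R \<alpha>; class_op G A x L R c c'; nonneg_marked G x L R c'\<rbrakk>
    \<Longrightarrow> c' \<in> class_graph G A x L R \<alpha>"

definition singles_defined_on :: "'v marked set \<Rightarrow> nat \<Rightarrow> bool" where
  "singles_defined_on P n \<longleftrightarrow> (\<forall>c\<in>P. single_asterisk c \<longrightarrow> stretching_class c n \<noteq> {})"

end

theory Submission
  imports Defs
begin

text \<open>
  Positive roots are sign coherent, and the depth of a positive root is the least number of simple
  reflections that make it negative. It follows that going down in the root poset is the same as
  reflecting at a vertex where the value drops to a smaller nonnegative value.

  Let \<open>S\<^sub>L\<close> and \<open>S\<^sub>R\<close> be the weighted sums over \<open>L\<^sub>x\<close> and \<open>R\<^sub>x\<close>, and consider the successive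
  differences of the sequence consisting of \<open>S\<^sub>L\<close>, the path values, and \<open>S\<^sub>R\<close>. Reflecting at a path
  vertex swaps two adjacent differences, and it decreases the value iff the larger difference moves
  to the right. Positive differences therefore travel right and negative ones travel left through
  the zeros of a plateau, and so the elements of a class are reached all at once. A decreasing
  reflection of an element of a class leaves the class only through one of the operations; the
  exception is a single marked value that is not repeated, which does not occur when \<open>n > n\<^sub>0\<close>.

  For the existence of \<open>n\<^sub>0\<close>: the number of nonzero differences, the number of nonnegative ones left of
  the marks and the number of nonpositive ones right of the marks grow only at reflections off the
  path, and each of these lowers the sum of the values off the path.
\<close>

section \<open>Root systems of generalized Cartan matrices\<close>

text \<open>Roots are studied for every integer matrix with diagonal 2, nonpositive off-diagonal
  entries and symmetric zero pattern, so that the results apply to \<open>A\<close> and to all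
  stretched matrices alike. No invariant symmetric form is assumed. Sign coherence is reduced to
  rank two, and length means length of operators, so that braid relations can be computed from the
  matrix entries. The obstacle in comparing \<open>P\<close> with the poset is that an operation may
  change the path length, while the poset lives on one fixed diagram. Lists mediate: an operation
  lifts to several descents of one fixed length, for suitably chosen multiplicities, and a descent
  projects to at most one operation. That the stretched function is a root at all needs its own
  argument: the reflection at \<open>x\<close> lifts to the product of the reflections at the path
  vertices taken from one end to the other and back. With \<open>t\<close> the sum of the values of
  \<open>\<alpha>\<close> off \<open>x\<close>, a class with one asterisk turns out to have at most
  \<open>2 + 4 * t\<close> unmarked path vertices; this is why a least \<open>n\<^sub>0\<close>
  exists.\<close>

locale cartan =
  fixes G :: "'v diagram" and A :: "'v \<Rightarrow> 'v \<Rightarrow> int"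
  assumes finite_verts: "finite (verts G)"
    and diag: "i \<in> verts G \<Longrightarrow> A i i = 2"
    and offdiag: "\<lbrakk>i \<in> verts G; j \<in> verts G; i \<noteq> j\<rbrakk> \<Longrightarrow> A i j \<le> 0"
    and zero_sym: "\<lbrakk>i \<in> verts G; j \<in> verts G; i \<noteq> j; A i j = 0\<rbrakk> \<Longrightarrow> A j i = 0"
begin

abbreviation "act \<equiv> foldr (simple_refl G A)"

text \<open>The simple coroot of \<open>i\<close> evaluated at \<open>\<beta>\<close>: the amount
  that reflection at \<open>i\<close> subtracts from coordinate \<open>i\<close>.\<close>

definition pairing :: "'v \<Rightarrow> ('v \<Rightarrow> int) \<Rightarrow> int" where
  "pairing i \<beta> = (\<Sum>j\<in>verts G. A i j * \<beta> j)"

lemma simple_refl_eq: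
  assumes "i \<in> verts G"
  shows "simple_refl G A i \<beta> = \<beta>(i := \<beta> i - pairing i \<beta>)"
proof -
  have "cartan_form G A (simple_root i) \<beta> = (\<Sum>k\<in>verts G. if k = i then pairing i \<beta> else 0)"
    unfolding cartan_form_def pairing_def simple_root_def
    by (intro sum.cong) auto
  also have "\<dots> = pairing i \<beta>" using assms finite_verts by simp
  finally show ?thesis by (auto simp: simple_refl_def simple_root_def)
qed

lemma pairing_linear:
  "pairing i (\<lambda>v. a * \<beta> v + b * \<gamma> v) = a * pairing i \<beta> + b * pairing i \<gamma>"
  by (simp add: pairing_def sum_distrib_left sum.distrib algebra_simps)

lemma pairing_simple_root: "j \<in> verts G \<Longrightarrow> pairing i (simple_root j) = A i j"
proof -
  assume "j \<in> verts G"
  have "pairing i (simple_root j) = (\<Sum>k\<in>verts G. if k = j then A i j else 0)"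
    unfolding pairing_def simple_root_def by (intro sum.cong) auto
  then show ?thesis using \<open>j \<in> verts G\<close> finite_verts by simp
qed

lemma pairing_upd:
  assumes "j \<in> verts G"
  shows "pairing i (\<beta>(j := c)) = pairing i \<beta> + A i j * (c - \<beta> j)"
proof -
  have "pairing i (\<beta>(j := c)) = (\<Sum>k\<in>verts G. A i k * \<beta> k + (if k = j then A i j * (c - \<beta> j) else 0))"
    unfolding pairing_def by (intro sum.cong) (auto simp: algebra_simps)
  then show ?thesis using assms finite_verts by (simp add: pairing_def sum.distrib)
qed

lemma simple_refl_involutive:
  "i \<in> verts G \<Longrightarrow> simple_refl G A i (simple_refl G A i \<beta>) = \<beta>"
  by (simp add: simple_refl_eq pairing_upd diag)

lemma simple_refl_linear:
  "i \<in> verts G \<Longrightarrow> simple_refl G A i (\<lambda>v. a * \<beta> v + b * \<gamma> v)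
    = (\<lambda>v. a * simple_refl G A i \<beta> v + b * simple_refl G A i \<gamma> v)"
  by (auto simp: simple_refl_eq pairing_linear algebra_simps)

lemma act_linear:
  "set w \<subseteq> verts G \<Longrightarrow> act w (\<lambda>v. a * \<beta> v + b * \<gamma> v) = (\<lambda>v. a * act w \<beta> v + b * act w \<gamma> v)"
  by (induction w) (simp_all add: simple_refl_linear)

lemma act_scale: "set w \<subseteq> verts G \<Longrightarrow> act w (\<lambda>v. a * \<beta> v) = (\<lambda>v. a * act w \<beta> v)"
  using act_linear[of w a \<beta> 0 \<beta>] by simp

lemma act_rev: "set w \<subseteq> verts G \<Longrightarrow> act (rev w) (act w \<beta>) = \<beta>"
  by (induction w arbitrary: \<beta>) (simp_all add: simple_refl_involutive)

lemma simple_refl_self: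
  "i \<in> verts G \<Longrightarrow> simple_refl G A i (simple_root i) = (\<lambda>v. - simple_root i v)"
  by (simp add: simple_refl_eq pairing_simple_root diag) (auto simp: simple_root_def)

subsection \<open>Rank two\<close>

text \<open>\<open>alt s t k\<close> is the alternating word of length \<open>k\<close> in \<open>s\<close> and \<open>t\<close> whose last letter,
  the one acting first, is \<open>t\<close>.\<close>

primrec alt :: "'v \<Rightarrow> 'v \<Rightarrow> nat \<Rightarrow> 'v list" where
  "alt s t 0 = []"
| "alt s t (Suc k) = (if even k then t else s) # alt s t k"

text \<open>Unfolds \<open>alt\<close> at the concrete orders 2, 3, 4 and 6 in the braid
  computation.\<close>

lemma alt_numeral:
  "alt s t (numeral n) = (if even (pred_numeral n) then t else s) # alt s t (pred_numeral n)"
  by (simp add: numeral_eq_Suc)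

lemma length_alt [simp]: "length (alt s t k) = k"
  by (induction k) auto

lemma set_alt: "set (alt s t k) \<subseteq> {s, t}"
  by (induction k) auto

lemma last_alt: "last (alt s t (Suc k)) = t"
  by (induction k) auto

lemma alt_suffix: "m \<le> k \<Longrightarrow> \<exists>z. alt s t k = z @ alt s t m"
proof (induction k)
  case (Suc k)
  then show ?case by (cases "m = Suc k") (auto simp: le_Suc_eq)
qed simp

text \<open>Without equal neighbours each of the two letters forces the one to its left, so the last
  letter and the length determine the word.\<close>

lemma alternating_word:
  assumes "set u \<subseteq> {s, t}" "u \<noteq> []" "last u = t" "successively (\<noteq>) u"
  shows "u = alt s t (length u)"
  using assms
proof (induction u)
  case (Cons y u)
  show ?case
  proof (cases u)
    case Nil
    then show ?thesis using Cons by auto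
  next
    case (Cons z u')
    have u: "u = alt s t (length u)" using Cons.IH Cons.prems Cons by auto
    have yz: "y \<noteq> z" "y \<in> {s, t}" using Cons Cons.prems by auto
    have "alt s t (length u) = (if even (length u') then t else s) # alt s t (length u')"
      using Cons by simp
    then have "z = (if even (length u') then t else s)" using Cons u by (metis list.inject)
    then have "y = (if even (length u) then t else s)" using yz Cons by auto
    then have "alt s t (length (y # u)) = y # alt s t (length u)" by simp
    then show ?thesis using u by metis
  qed
qed simp

text \<open>The coefficients of \<open>alt s t k\<close> applied to the simple root \<open>s\<close>, where
  \<open>a = - A t s\<close> and \<open>b = - A s t\<close>.\<close>

primrec alt_coeffs :: "int \<Rightarrow> int \<Rightarrow> nat \<Rightarrow> int \<times> int" where
  "alt_coeffs a b 0 = (1, 0)"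
| "alt_coeffs a b (Suc k) = (case alt_coeffs a b k of (p, q) \<Rightarrow>
     if even k then (p, a * p - q) else (b * q - p, q))"

lemma act_alt:
  assumes "s \<in> verts G" "t \<in> verts G" "s \<noteq> t"
  shows "act (alt s t k) (simple_root s) =
    (\<lambda>v. fst (alt_coeffs (- A t s) (- A s t) k) * simple_root s v
       + snd (alt_coeffs (- A t s) (- A s t) k) * simple_root t v)"
proof (induction k)
  case (Suc k)
  obtain p q where pq: "alt_coeffs (- A t s) (- A s t) k = (p, q)" by force
  have "simple_refl G A i (\<lambda>v. p * simple_root s v + q * simple_root t v) =
      (\<lambda>v. p * simple_root s v + q * simple_root t v - (p * A i s + q * A i t) * simple_root i v)"
    if "i \<in> verts G" for i
    using that assms
    by (simp add: simple_refl_eq pairing_linear pairing_simple_root)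
      (auto simp: simple_root_def fun_eq_iff)
  then show ?case using Suc assms
    by (simp add: pq diag) (simp add: algebra_simps)
qed simp

text \<open>The last clause strengthens the induction: it says that the coefficient changed next
  does not decrease. It propagates because \<open>a * p \<ge> 2 * q\<close> and
  \<open>a * b \<ge> 4\<close> give \<open>b * (a * p - q) \<ge> 2 * p\<close>, and
  symmetrically.\<close>

lemma alt_coeffs_infinite:
  assumes "a \<ge> 0" "b \<ge> 0" "a * b \<ge> 4"
  shows "0 \<le> fst (alt_coeffs a b k) \<and> 0 \<le> snd (alt_coeffs a b k) \<and>
    (if even k then a * fst (alt_coeffs a b k) \<ge> 2 * snd (alt_coeffs a b k)
     else b * snd (alt_coeffs a b k) \<ge> 2 * fst (alt_coeffs a b k))"
proof (induction k)
  case (Suc k)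
  obtain p q where pq: "alt_coeffs a b k = (p, q)" by force
  have "4 * p \<le> a * b * p" "4 * q \<le> a * b * q"
    using Suc pq assms(3) by (auto intro: mult_right_mono)
  moreover have "a * p \<ge> 2 * q \<Longrightarrow> b * (a * p) \<ge> b * (2 * q)" "b * q \<ge> 2 * p \<Longrightarrow> a * (b * q) \<ge> a * (2 * p)"
    using assms mult_left_mono by blast+
  ultimately show ?case using Suc pq by (auto simp: algebra_simps)
qed (use assms in auto)

text \<open>The bracketed term is the contribution of the coordinates other than \<open>s\<close>
  and \<open>t\<close>. It is independent of \<open>p\<close> and \<open>q\<close>, so each
  reflection is an affine map of the pair with a fixed constant.\<close>

lemma refl_pair:
  assumes "s \<in> verts G" "t \<in> verts G" "s \<noteq> t"
  shows "simple_refl G A s (\<beta>(s := p, t := q)) =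
      \<beta>(s := - A s t * q - p - (pairing s \<beta> - 2 * \<beta> s - A s t * \<beta> t), t := q)"
    and "simple_refl G A t (\<beta>(s := p, t := q)) =
      \<beta>(s := p, t := - A t s * p - q - (pairing t \<beta> - A t s * \<beta> s - 2 * \<beta> t))"
  using assms by (auto simp: simple_refl_eq pairing_upd diag algebra_simps)

text \<open>These are the rank two types A1 x A1, A2, B2 and G2, the last two in both
  orientations.\<close>

lemma small_products:
  fixes a b :: int
  assumes "a \<ge> 0" "b \<ge> 0" "a * b < 4" "a = 0 \<longleftrightarrow> b = 0"
  shows "(a, b) \<in> {(0,0), (1,1), (1,2), (2,1), (1,3), (3,1)}"
proof (cases "a = 0")
  case False
  then have "a \<ge> 1" "b \<ge> 1" using assms by auto
  then have "a \<le> a * b" "b \<le> a * b" by (simp_all add: mult_le_cancel_left1 mult_le_cancel_right1)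
  then have "a < 4" "b < 4" using assms(3) by linarith+
  then have "a = 1 \<or> a = 2 \<or> a = 3" "b = 1 \<or> b = 2 \<or> b = 3" using \<open>a \<ge> 1\<close> \<open>b \<ge> 1\<close> by linarith+
  then show ?thesis using assms(3) by auto
qed (use assms in auto)

text \<open>The products 0, 1, 2, 3 of the two entries belong to the orders 2, 3, 4, 6. The
  operators act on all functions, not only on the plane of the two simple roots; the other
  coordinates enter through the constants \<open>X\<close> and \<open>Y\<close>, and the claim
  becomes an identity of affine maps in two variables.\<close>

lemma braid:
  assumes "s \<in> verts G" "t \<in> verts G" "s \<noteq> t"
    and ab: "(- A t s, - A s t) = (a, b)"
    and "(a, b, m) \<in> {(0,0,2), (1,1,3), (1,2,4), (2,1,4), (1,3,6), (3,1,6)}"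
  shows "act (alt s t m) = act (alt t s m)"
proof
  fix \<beta> :: "'v \<Rightarrow> int"
  define X where "X = pairing s \<beta> - 2 * \<beta> s - A s t * \<beta> t"
  define Y where "Y = pairing t \<beta> - A t s * \<beta> s - 2 * \<beta> t"
  have rs: "simple_refl G A s (\<beta>(s := p, t := q)) = \<beta>(s := b * q - p - X, t := q)" for p q
    unfolding X_def using refl_pair(1)[OF assms(1-3)] ab by auto
  have rt: "simple_refl G A t (\<beta>(s := p, t := q)) = \<beta>(s := p, t := a * p - q - Y)" for p q
    unfolding Y_def using refl_pair(2)[OF assms(1-3)] ab by auto
  have "act (alt s t m) (\<beta>(s := p, t := q)) = act (alt t s m) (\<beta>(s := p, t := q))" for p q
    using assms(5)
    by (elim insertE emptyE) (simp_all add: alt_numeral rs rt, simp_all add: fun_eq_iff)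
  from this[of "\<beta> s" "\<beta> t"] show "act (alt s t m) \<beta> = act (alt t s m) \<beta>" by simp
qed

text \<open>An entry product of at least 4 is the infinite dihedral case. Smaller products leave six
  matrices, for which a braid relation is known and the finitely many coefficients before it are
  checked one by one.\<close>

lemma dihedral:
  assumes st: "s \<in> verts G" "t \<in> verts G" "s \<noteq> t"
  defines "c \<equiv> alt_coeffs (- A t s) (- A s t)"
  obtains "\<And>k. 0 \<le> fst (c k) \<and> 0 \<le> snd (c k)"
  | m where "m > 0" "act (alt s t m) = act (alt t s m)"
      "\<And>k. k < m \<Longrightarrow> 0 \<le> fst (c k) \<and> 0 \<le> snd (c k)"
proof -
  define a where "a = - A t s"
  define b where "b = - A s t"
  have nn: "a \<ge> 0" "b \<ge> 0" using offdiag st by (auto simp: a_def b_def)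
  have z: "a = 0 \<longleftrightarrow> b = 0" using zero_sym st by (auto simp: a_def b_def)
  show thesis
  proof (cases "a * b \<ge> 4")
    case True
    then show thesis using alt_coeffs_infinite[OF nn] that(1) by (auto simp: c_def a_def b_def)
  next
    case False
    then have "(a, b) \<in> {(0,0), (1,1), (1,2), (2,1), (1,3), (3,1)}"
      using small_products nn z by auto
    then obtain m :: nat where m: "(a, b, m) \<in> {(0,0,2), (1,1,3), (1,2,4), (2,1,4), (1,3,6), (3,1,6)}"
      by auto
    have "0 \<le> fst (alt_coeffs a b k) \<and> 0 \<le> snd (alt_coeffs a b k)" if "k < m" for k
    proof -
      have "k \<in> {0, 1, 2, 3, 4, 5}" using that m by auto
      then show ?thesis using m that by (auto simp: numeral_eq_Suc)
    qed
    moreover have "m > 0" using m by auto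
    ultimately show thesis
      using that(2)[of m] braid[OF st _ m] unfolding c_def a_def b_def by blast
  qed
qed

subsection \<open>Length and sign coherence\<close>

text \<open>Length of the operator given by \<open>w\<close>. Words with the same action thus have
  the same length, and any relation verified for operators may be used to rewrite words.\<close>

definition len :: "'v list \<Rightarrow> nat" where
  "len w = (LEAST n. \<exists>w'. set w' \<subseteq> verts G \<and> length w' = n \<and> act w' = act w)"

lemma len_le: "\<lbrakk>set w' \<subseteq> verts G; act w' = act w\<rbrakk> \<Longrightarrow> len w \<le> length w'"
  unfolding len_def by (rule Least_le) blast

lemma reduced_word:
  assumes "set w \<subseteq> verts G"
  obtains w' where "set w' \<subseteq> verts G" "length w' = len w" "act w' = act w"
  using LeastI_ex[of "\<lambda>n. \<exists>w'. set w' \<subseteq> verts G \<and> length w' = n \<and> act w' = act w"] assms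
  unfolding len_def by blast

lemma len_cong: "act w = act w' \<Longrightarrow> len w = len w'"
  by (simp add: len_def)

lemma act_cancel: "i \<in> verts G \<Longrightarrow> act (u @ i # i # v) = act (u @ v)"
  by (rule ext) (simp add: simple_refl_involutive)

lemma not_successively_neq:
  "\<not> successively (\<noteq>) u \<Longrightarrow> \<exists>u1 i u2. u = u1 @ i # i # u2"
proof (induction u)
  case (Cons a u)
  show ?case
  proof (cases u)
    case (Cons b v)
    show ?thesis
    proof (cases "a = b")
      case True
      then show ?thesis using Cons by (intro exI[of _ "[]"]) auto
    next
      case False
      then have "\<not> successively (\<noteq>) u" using Cons.prems Cons by auto
      then obtain u1 i u2 where "u = u1 @ i # i # u2" using Cons.IH by blast
      then show ?thesis by (intro exI[of _ "a # u1"]) auto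
    qed
  qed (use Cons.prems in auto)
qed simp

text \<open>Induction on the length of \<open>w\<close>. Splitting off a right factor
  \<open>u\<close> in the letters \<open>s\<close> and \<open>t\<close> that is as long as possible
  leaves a left factor \<open>v\<close> which keeps both simple roots nonnegative by induction,
  while \<open>u\<close> sends the simple root \<open>s\<close> to a nonnegative combination of the
  two by the rank two analysis.\<close>

lemma act_simple_root_nonneg:
  assumes "set w \<subseteq> verts G" "s \<in> verts G" "len (w @ [s]) \<ge> len w"
  shows "0 \<le> act w (simple_root s) v"
  using assms
proof (induction "len w" arbitrary: w s v rule: less_induct)
  case less
  obtain w' where w': "set w' \<subseteq> verts G" "length w' = len w" "act w' = act w"
    using reduced_word less.prems(1) by blast
  show ?case
  proof (cases "w' = []")
    case True
    then show ?thesis using w'(3)[symmetric] by (simp add: simple_root_def)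
  next
    case False
    define t where "t = last w'"
    have t: "t \<in> verts G" "w' = butlast w' @ [t]"
      using False w'(1) by (auto simp: t_def)
    \<comment> \<open>No word for \<open>w\<close> of length at most \<open>len w\<close> ends in
      \<open>s\<close>: deleting that letter would make \<open>w @ [s]\<close> shorter than
      \<open>w\<close>.\<close>
    have drop_s: False if "act (z @ [s]) = act w" "set z \<subseteq> verts G" "length z < len w" for z
    proof -
      have "act (w @ [s]) = act (z @ [s] @ [s])" using that(1) by (simp add: fun_eq_iff)
      also have "\<dots> = act z" using act_cancel[of s z "[]"] less.prems(2) by simp
      finally show False using len_le[of z "w @ [s]"] that less.prems(3) by simp
    qed
    have "s \<noteq> t" using drop_s[of "butlast w'"] t w' in_set_butlastD
      by (metis One_nat_def diff_less length_butlast length_greater_0_conv False subset_iff zero_less_one)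
    \<comment> \<open>Factorizations with additive lengths and right factor in \<open>s\<close> and
      \<open>t\<close>. A shortest left factor plays the role of the minimal coset representative
      modulo the dihedral subgroup.\<close>
    define D where "D = (\<lambda>v u. set v \<subseteq> verts G \<and> set u \<subseteq> {s, t} \<and>
      length v + length u = len w \<and> act (v @ u) = act w)"
    have "length (butlast w') + length [t] = len w"
      using t(2) w'(2) by (metis length_append)
    then have D0: "D (butlast w') [t]"
      unfolding D_def using t w' by (auto dest: in_set_butlastD)
    define k where "k = (LEAST k. \<exists>v u. D v u \<and> length v = k)"
    have "\<exists>v u. D v u \<and> length v = k"
      unfolding k_def by (rule LeastI_ex) (use D0 in blast)
    then obtain v u where vu: "D v u" "length v = k" by blast
    have k_min: "k \<le> length v'" if "D v' u'" for v' u'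
      unfolding k_def by (rule Least_le) (use that in blast)
    have vV: "set v \<subseteq> verts G" and uV: "set u \<subseteq> verts G" and ust: "set u \<subseteq> {s, t}"
      and lvu: "length v + length u = len w" and avu: "act (v @ u) = act w"
      using vu less.prems t unfolding D_def by auto
    have vw: "length v < len w"
      using k_min[OF D0] \<open>length (butlast w') + length [t] = len w\<close> vu(2) by simp
    have len_v: "len v = length v"
    proof (rule ccontr)
      obtain v' where v': "set v' \<subseteq> verts G" "length v' = len v" "act v' = act v"
        using reduced_word vV by blast
      assume "len v \<noteq> length v"
      then have "length v' < length v" using len_le[OF vV refl] v' by simp
      moreover have "act (v' @ u) = act w" using v'(3) avu by (simp add: fun_eq_iff)
      ultimately show False using len_le[of "v' @ u" w] v' uV lvu by auto
    qed
    have step: "0 \<le> act v (simple_root i) y" if i: "i \<in> {s, t}" for i y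
    proof (rule less.hyps)
      show "len v < len w" using vw len_v by simp
      show iV: "i \<in> verts G" using i less.prems t by auto
      show "set v \<subseteq> verts G" by fact
      show "len v \<le> len (v @ [i])"
      proof (rule ccontr)
        assume "\<not> ?thesis"
        \<comment> \<open>If \<open>v @ [i]\<close> had a shorter word, the letter \<open>i\<close>
          could be handed over to the right factor, against the minimality of
          \<open>k\<close>.\<close>
        then obtain v' where v': "set v' \<subseteq> verts G" "length v' < length v" "act v' = act (v @ [i])"
          using reduced_word[of "v @ [i]"] vV iV len_v by (metis bot.extremum insert_subset
              list.set(1) list.simps(15) not_le set_append sup.bounded_iff)
        have "act (v' @ i # u) = act w"
          using v'(3) avu act_cancel[OF iV, of v u] by (simp add: fun_eq_iff)
        moreover from this have "len w \<le> length (v' @ i # u)"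
          by (intro len_le) (use v' uV iV in auto)
        ultimately have "D v' (i # u)" unfolding D_def using v' lvu ust i by auto
        then show False using k_min v'(2) vu(2) by fastforce
      qed
    qed
    have u0: "u \<noteq> []" using vw lvu by auto
    have lu: "last u = t"
    proof (rule ccontr)
      assume "last u \<noteq> t"
      then have "last u = s" using ust u0 last_in_set by fastforce
      then have u: "u = butlast u @ [s]" using u0 by (metis append_butlast_last_id)
      have "act ((v @ butlast u) @ [s]) = act w" using avu u by (metis append.assoc)
      moreover have "set (v @ butlast u) \<subseteq> verts G" using vV uV by (auto dest: in_set_butlastD)
      moreover have "length (v @ butlast u) < len w" using lvu u0
        by (metis append.assoc length_append_singleton length_append u lessI)
      ultimately show False using drop_s by blast
    qed
    have "successively (\<noteq>) u"
    proof (rule ccontr)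
      assume "\<not> ?thesis"
      then obtain u1 i u2 where u: "u = u1 @ i # i # u2" using not_successively_neq by blast
      then have "act (v @ u1 @ u2) = act w"
        using avu act_cancel[of i "v @ u1" u2] uV by simp
      then show False using len_le[of "v @ u1 @ u2" w] u vV uV lvu by auto
    qed
    then have u: "u = alt s t (length u)" using alternating_word ust u0 lu by blast
    define c where "c = alt_coeffs (- A t s) (- A s t)"
    have c: "0 \<le> fst (c (length u)) \<and> 0 \<le> snd (c (length u))"
      using less.prems(2) t(1) \<open>s \<noteq> t\<close>
    proof (cases rule: dihedral)
      case (2 m)
      \<comment> \<open>Otherwise the braid relation could be applied at the right end of
        \<open>u\<close>, giving an equally long word for \<open>w\<close> that ends in
        \<open>s\<close>, which \<open>drop_s\<close> forbids.\<close>
      have "length u < m"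
      proof (rule ccontr)
        assume "\<not> length u < m"
        then obtain z where z: "u = z @ alt s t m" using alt_suffix[of m "length u" s t] u by auto
        obtain m' where m': "m = Suc m'" using 2(1) gr0_implies_Suc by blast
        define y where "y = butlast (alt t s m)"
        have y: "alt t s m = y @ [s]" unfolding y_def m'
          using last_alt[of t s m'] by (metis append_butlast_last_id alt.simps(2) list.discI)
        have ly: "length y = m'" using y m' by (metis length_alt length_append_singleton nat.inject)
        have "set y \<subseteq> verts G" using set_alt[of t s m] y less.prems(2) t(1) by auto
        moreover have "act ((v @ z @ y) @ [s]) = act w"
          using avu z y 2(2) by (simp add: fun_eq_iff)
        moreover have "length (v @ z @ y) < len w" using lvu z ly m' by simp
        ultimately show False using drop_s[of "v @ z @ y"] vV uV z by auto
      qed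
      then show ?thesis using 2(3) by (simp add: c_def)
    qed (simp add: c_def)
    have "act w (simple_root s) = act v (act (alt s t (length u)) (simple_root s))"
      using avu u by (metis foldr_append comp_apply)
    also have "\<dots> = act v (\<lambda>v. fst (c (length u)) * simple_root s v + snd (c (length u)) * simple_root t v)"
      using act_alt less.prems(2) t(1) \<open>s \<noteq> t\<close> by (simp add: c_def)
    also have "\<dots> = (\<lambda>y. fst (c (length u)) * act v (simple_root s) y
        + snd (c (length u)) * act v (simple_root t) y)"
      using act_linear vV by blast
    finally show ?thesis using step c by simp
  qed
qed

lemma act_uminus: "set w \<subseteq> verts G \<Longrightarrow> act w (\<lambda>v. - \<beta> v) = (\<lambda>v. - act w \<beta> v)"
  using act_scale[of w "-1" \<beta>] by simp

lemma root_system_act: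
  "\<lbrakk>\<beta> \<in> root_system G A; set w \<subseteq> verts G\<rbrakk> \<Longrightarrow> act w \<beta> \<in> root_system G A"
  unfolding root_system_def is_expression_def by clarsimp (metis Un_subset_iff foldr_append comp_apply set_append)

lemma simple_refl_root_system:
  "\<lbrakk>\<beta> \<in> root_system G A; i \<in> verts G\<rbrakk> \<Longrightarrow> simple_refl G A i \<beta> \<in> root_system G A"
  using root_system_act[of \<beta> "[i]"] by simp

text \<open>If appending \<open>y\<close> does not shorten \<open>w\<close>, the root is
  nonnegative. If it does, the same result applies to \<open>w @ [y]\<close>, which sends the simple
  root \<open>y\<close> to the negative of the root.\<close>

lemma root_sign:
  assumes "\<beta> \<in> root_system G A"
  shows "(\<forall>v. 0 \<le> \<beta> v) \<or> (\<forall>v. \<beta> v \<le> 0)"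
proof -
  obtain w y where wy: "set w \<subseteq> verts G" "y \<in> verts G" "\<beta> = act w (simple_root y)"
    using assms by (auto simp: root_system_def is_expression_def)
  show ?thesis
  proof (cases "len (w @ [y]) \<ge> len w")
    case True
    then show ?thesis using act_simple_root_nonneg wy by blast
  next
    case False
    have "act ((w @ [y]) @ [y]) = act w" using act_cancel[of y w "[]"] wy by simp
    then have "len ((w @ [y]) @ [y]) = len w" by (rule len_cong)
    then have "0 \<le> act (w @ [y]) (simple_root y) v" for v
      using act_simple_root_nonneg[of "w @ [y]" y v] False wy by simp
    then have "\<beta> v \<le> 0" for v
      using simple_refl_self[of y] act_uminus[of w "simple_root y"] wy by simp
    then show ?thesis by blast
  qed
qed

subsection \<open>Depth\<close>

lemma root_support: "\<lbrakk>\<beta> \<in> root_system G A; v \<notin> verts G\<rbrakk> \<Longrightarrow> \<beta> v = 0"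
proof -
  have "act w (simple_root y) v = 0" if "set w \<subseteq> verts G" "y \<in> verts G" "v \<notin> verts G" for w y
    using that by (induction w) (auto simp: simple_refl_eq simple_root_def)
  then show "\<lbrakk>\<beta> \<in> root_system G A; v \<notin> verts G\<rbrakk> \<Longrightarrow> \<beta> v = 0"
    by (auto simp: root_system_def is_expression_def)
qed

text \<open>Roots vanish off the vertices, so signs may be compared on the whole type.\<close>

lemma pos_roots_iff: "\<beta> \<in> pos_roots G A \<longleftrightarrow> \<beta> \<in> root_system G A \<and> (\<forall>v. 0 \<le> \<beta> v)"
  unfolding pos_roots_def using root_support by auto (metis order_refl)

text \<open>Roots are primitive: the inverse word carries the factor \<open>c\<close> to a simple
  root, where it divides the coordinate 1.\<close>

lemma root_proportional:
  assumes "\<beta> \<in> root_system G A" "\<beta> = (\<lambda>v. c * \<gamma> v)" "c \<ge> 0"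
  shows "c = 1"
proof -
  obtain w y where wy: "set w \<subseteq> verts G" "y \<in> verts G" "\<beta> = act w (simple_root y)"
    using assms by (auto simp: root_system_def is_expression_def)
  have "simple_root y = act (rev w) \<beta>" using wy act_rev by simp
  also have "\<dots> = (\<lambda>v. c * act (rev w) \<gamma> v)" unfolding assms(2) by (rule act_scale) (use wy in simp)
  finally have "1 = c * act (rev w) \<gamma> y" by (metis simple_root_def)
  then show ?thesis using assms(3) by (metis dvd_triv_left zdvd1_eq abs_of_nonneg)
qed

text \<open>Reflection at \<open>i\<close> alters coordinate \<open>i\<close> only, so every other
  coordinate is both nonnegative and nonpositive. A multiple of a simple root remains, and roots are
  primitive.\<close>

lemma sign_change_at_simple_root:
  assumes "\<beta> \<in> root_system G A" "\<forall>v. 0 \<le> \<beta> v" "i \<in> verts G" "\<forall>v. simple_refl G A i \<beta> v \<le> 0"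
  shows "\<beta> = simple_root i"
proof -
  have "\<beta> v = 0" if "v \<noteq> i" for v
    using assms(2-4) that by (metis simple_refl_eq fun_upd_other order_antisym)
  then have \<beta>: "\<beta> = (\<lambda>v. \<beta> i * simple_root i v)" by (auto simp: simple_root_def)
  then have "\<beta> i = 1" using root_proportional assms(1,2) by blast
  then show ?thesis using \<beta> by simp
qed

lemma depth_le: "is_expression G A \<beta> w y \<Longrightarrow> depth G A \<beta> \<le> Suc (length w)"
  unfolding depth_def by (simp, rule Least_le) blast

lemma depth_expression:
  assumes "\<beta> \<in> root_system G A"
  obtains w y where "is_expression G A \<beta> w y" "depth G A \<beta> = Suc (length w)"
  using LeastI_ex[of "\<lambda>l. \<exists>w y. is_expression G A \<beta> w y \<and> length w = l"] assms
  unfolding depth_def root_system_def by auto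

lemma root_nonzero: "\<beta> \<in> root_system G A \<Longrightarrow> \<exists>v. \<beta> v \<noteq> 0"
proof (rule ccontr)
  assume \<beta>: "\<beta> \<in> root_system G A" "\<nexists>v. \<beta> v \<noteq> 0"
  then have "\<beta> = (\<lambda>v. 0 * \<beta> v)" by auto
  then show False using root_proportional[OF \<beta>(1), of 0 \<beta>] by simp
qed

text \<open>Let the letters act one after another, from the right. Just before the sign changes the
  root is the simple root of the letter that acts next; undoing the letters that have acted gives an
  expression of \<open>\<gamma>\<close>.\<close>

lemma depth_le_negative:
  assumes "\<gamma> \<in> pos_roots G A" "set w \<subseteq> verts G" "\<forall>v. act w \<gamma> v \<le> 0"
  shows "depth G A \<gamma> \<le> length w"
  using assms(2,3)
proof (induction w)
  case Nil
  then have "\<gamma> v = 0" for v using assms(1) by (simp add: pos_roots_iff order_antisym)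
  then show ?case using root_nonzero assms(1) pos_roots_iff by blast
next
  case (Cons t w)
  show ?case
  proof (cases "\<forall>v. act w \<gamma> v \<le> 0")
    case True
    then show ?thesis using Cons by simp
  next
    case False
    have root: "act w \<gamma> \<in> root_system G A"
      using assms(1) Cons.prems root_system_act by (auto simp: pos_roots_iff)
    then have "\<forall>v. 0 \<le> act w \<gamma> v" using False root_sign by blast
    then have "act w \<gamma> = simple_root t"
      using sign_change_at_simple_root[OF root] Cons.prems by auto
    then have "\<gamma> = act (rev w) (simple_root t)" using act_rev[of w \<gamma>] Cons.prems by simp
    then have "is_expression G A \<gamma> (rev w) t" using Cons.prems by (simp add: is_expression_def)
    then show ?thesis using depth_le by fastforce
  qed
qed

text \<open>Prefixing \<open>s\<close> to an expression gives one inequality. For the other, take a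
  shortest \<open>w\<close> that makes \<open>\<gamma>\<close> negative; its length is the depth. If
  appending \<open>s\<close> shortens \<open>w\<close>, the shorter word makes the reflected root
  negative; otherwise \<open>w\<close> without its leftmost letter does so.\<close>

lemma depth_descent:
  assumes "\<gamma> \<in> pos_roots G A" "s \<in> verts G" "pairing s \<gamma> > 0"
    and "simple_refl G A s \<gamma> \<in> pos_roots G A"
  shows "depth G A \<gamma> = Suc (depth G A (simple_refl G A s \<gamma>))"
proof (rule antisym)
  have "simple_refl G A s \<gamma> \<in> root_system G A" using assms(4) by (simp add: pos_roots_iff)
  then obtain w y where w: "is_expression G A (simple_refl G A s \<gamma>) w y"
      "depth G A (simple_refl G A s \<gamma>) = Suc (length w)"
    using depth_expression by blast
  then have "is_expression G A \<gamma> (s # w) y"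
    using assms(2) simple_refl_involutive[OF assms(2), of \<gamma>] by (simp add: is_expression_def)
  then show "depth G A \<gamma> \<le> Suc (depth G A (simple_refl G A s \<gamma>))" using depth_le w(2) by fastforce
next
  let ?d = "depth G A \<gamma>"
  have \<gamma>: "\<gamma> \<in> root_system G A" "\<forall>v. 0 \<le> \<gamma> v" using assms(1) pos_roots_iff by auto
  then obtain z y where z: "set z \<subseteq> verts G" "y \<in> verts G" "\<gamma> = act z (simple_root y)" "?d = Suc (length z)"
    using depth_expression[OF \<gamma>(1)] unfolding is_expression_def by metis
  \<comment> \<open>The word \<open>rev z\<close> takes \<open>\<gamma>\<close> back to the simple
    root \<open>y\<close>, and the letter \<open>y\<close> then negates it.\<close>
  obtain w where w: "set w \<subseteq> verts G" "length w = len (y # rev z)" "act w = act (y # rev z)"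
    using reduced_word[of "y # rev z"] z by auto
  have neg: "\<forall>v. act w \<gamma> v \<le> 0"
    using w(3) z act_rev[OF z(1), of "simple_root y"] simple_refl_self[OF z(2)]
    by (simp add: simple_root_def)
  have lw: "length w = ?d"
  proof (rule antisym)
    show "length w \<le> ?d" using len_le[of "y # rev z" "y # rev z"] z w(2) by simp
    show "?d \<le> length w" using depth_le_negative assms(1) w(1) neg by blast
  qed
  have len_w: "len w = length w" using w(2,3) len_cong by simp
  show "Suc (depth G A (simple_refl G A s \<gamma>)) \<le> ?d"
  proof (cases "len (w @ [s]) < len w")
    case True
    obtain u where u: "set u \<subseteq> verts G" "length u = len (w @ [s])" "act u = act (w @ [s])"
      using reduced_word[of "w @ [s]"] w(1) assms(2) by auto
    have "act u (simple_refl G A s \<gamma>) = act w \<gamma>"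
      using u(3) simple_refl_involutive[OF assms(2), of \<gamma>] by simp
    then have "depth G A (simple_refl G A s \<gamma>) \<le> length u"
      using depth_le_negative assms(4) u(1) neg by simp
    then show ?thesis using True u(2) len_w lw by simp
  next
    case False
    then have pos: "0 \<le> act w (simple_root s) v" for v
      using act_simple_root_nonneg w(1) assms(2) by simp
    obtain t u where tu: "w = t # u" using lw z(4) by (metis length_Suc_conv)
    have u: "set u \<subseteq> verts G" "t \<in> verts G" using w(1) tu by auto
    have u\<gamma>: "act u \<gamma> \<in> root_system G A" using root_system_act \<gamma>(1) u(1) by blast
    \<comment> \<open>\<open>u\<close> is too short to make \<open>\<gamma>\<close> negative, so the
      sign changes at the letter \<open>t\<close>.\<close>
    have "\<not> (\<forall>v. act u \<gamma> v \<le> 0)"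
      using depth_le_negative[OF assms(1) u(1)] lw tu by auto
    then have "act u \<gamma> = simple_root t"
      using sign_change_at_simple_root[OF u\<gamma>] root_sign[OF u\<gamma>] u(2) neg tu by auto
    have "simple_refl G A s \<gamma> = (\<lambda>v. 1 * \<gamma> v + (- pairing s \<gamma>) * simple_root s v)"
      using assms(2) by (auto simp: simple_refl_eq simple_root_def)
    then have us: "act u (simple_refl G A s \<gamma>) = (\<lambda>v. simple_root t v - pairing s \<gamma> * act u (simple_root s) v)"
      using act_linear[OF u(1), of 1 \<gamma> "- pairing s \<gamma>" "simple_root s"] \<open>act u \<gamma> = simple_root t\<close>
      by simp
    \<comment> \<open>If this root were positive, then off \<open>t\<close> the image of the simple
      root \<open>s\<close> under \<open>u\<close> would be nonpositive. It is also nonnegative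
      there, because \<open>t\<close> changes coordinate \<open>t\<close> alone. So it is a multiple
      of \<open>act u \<gamma>\<close>, which forces \<open>\<gamma>\<close> to be the simple root
      \<open>s\<close>, whose reflection is negative.\<close>
    have "\<forall>v. act u (simple_refl G A s \<gamma>) v \<le> 0"
    proof (rule ccontr)
      assume "\<not> ?thesis"
      moreover have "act u (simple_refl G A s \<gamma>) \<in> root_system G A"
        using root_system_act assms(4) u(1) pos_roots_iff by blast
      ultimately have nn: "0 \<le> act u (simple_refl G A s \<gamma>) v" for v using root_sign by blast
      have "act u (simple_root s) v = 0" if "v \<noteq> t" for v
      proof -
        have "act w (simple_root s) v = act u (simple_root s) v"
          using that u(2) by (simp add: tu simple_refl_eq)
        then have "0 \<le> act u (simple_root s) v" using pos[of v] by simp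
        moreover have "pairing s \<gamma> * act u (simple_root s) v \<le> 0"
          using nn[of v] that us by (simp add: simple_root_def)
        ultimately show ?thesis using assms(3) by (simp add: mult_le_0_iff)
      qed
      then have "act u (simple_root s) = (\<lambda>v. act u (simple_root s) t * act u \<gamma> v)"
        using \<open>act u \<gamma> = simple_root t\<close> by (auto simp: simple_root_def)
      then have "act (rev u) (act u (simple_root s)) = (\<lambda>v. act u (simple_root s) t * act (rev u) (act u \<gamma>) v)"
        using act_scale[of "rev u" "act u (simple_root s) t" "act u \<gamma>"] u(1) by simp
      then have k: "simple_root s = (\<lambda>v. act u (simple_root s) t * \<gamma> v)"
        using act_rev[OF u(1)] by simp
      then have "1 = act u (simple_root s) t * \<gamma> s" by (metis simple_root_def)
      then have "act u (simple_root s) t = 1"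
        using \<gamma>(2) by (metis dvd_triv_right zdvd1_eq abs_of_nonneg mult.right_neutral)
      then have "\<gamma> = simple_root s" using k by simp
      then have "simple_refl G A s \<gamma> s = - 1" using simple_refl_self[OF assms(2)] by (simp add: simple_root_def)
      then show False using assms(4) pos_roots_iff by (metis neg_0_le_iff_le not_one_le_zero)
    qed
    then have "depth G A (simple_refl G A s \<gamma>) \<le> length u"
      using depth_le_negative[OF assms(4) u(1)] by blast
    then show ?thesis using lw tu by simp
  qed
qed

section \<open>The root poset in terms of decreasing values\<close>

definition descent :: "('v \<Rightarrow> int) \<Rightarrow> ('v \<Rightarrow> int) \<Rightarrow> bool" where
  "descent \<gamma> \<beta> \<longleftrightarrow> (\<exists>i\<in>verts G. \<beta> = simple_refl G A i \<gamma> \<and> \<beta> i < \<gamma> i \<and> 0 \<le> \<beta> i)"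

lemma descent_pos_roots:
  assumes "descent \<gamma> \<beta>" "\<gamma> \<in> pos_roots G A"
  shows "\<beta> \<in> pos_roots G A"
proof -
  obtain i where i: "i \<in> verts G" "\<beta> = simple_refl G A i \<gamma>" "0 \<le> \<beta> i"
    using assms(1) descent_def by blast
  then have "0 \<le> \<beta> v" for v
    using assms(2) by (cases "v = i") (auto simp: simple_refl_eq pos_roots_iff)
  then show ?thesis using i assms(2) simple_refl_root_system by (auto simp: pos_roots_iff)
qed

text \<open>Along a step upwards the pairing at the lower root is not positive, since reflecting
  would then lower the depth, and not zero, since the root would be fixed; hence the value
  rises.\<close>

lemma root_step_iff: "root_step G A \<beta> \<gamma> \<longleftrightarrow> \<gamma> \<in> pos_roots G A \<and> descent \<gamma> \<beta>"
proof
  assume "root_step G A \<beta> \<gamma>"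
  then obtain i where i: "\<beta> \<in> pos_roots G A" "\<gamma> \<in> pos_roots G A" "i \<in> verts G"
      "\<gamma> = simple_refl G A i \<beta>" "depth G A \<gamma> = depth G A \<beta> + 1"
    unfolding root_step_def by blast
  have "\<not> pairing i \<beta> > 0" using depth_descent[OF i(1,3)] i by auto
  moreover have "pairing i \<beta> \<noteq> 0" using i by (auto simp: simple_refl_eq)
  ultimately have "\<beta> i < \<gamma> i" using i by (simp add: simple_refl_eq)
  then show "\<gamma> \<in> pos_roots G A \<and> descent \<gamma> \<beta>"
    using i simple_refl_involutive[OF i(3), of \<beta>] unfolding descent_def pos_roots_iff by metis
next
  assume *: "\<gamma> \<in> pos_roots G A \<and> descent \<gamma> \<beta>"
  then obtain i where i: "i \<in> verts G" "\<beta> = simple_refl G A i \<gamma>" "\<beta> i < \<gamma> i"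
    using descent_def by blast
  have \<beta>: "\<beta> \<in> pos_roots G A" using * descent_pos_roots by blast
  have "pairing i \<gamma> > 0" using i by (simp add: simple_refl_eq)
  then have "depth G A \<gamma> = Suc (depth G A \<beta>)" using depth_descent * i \<beta> by simp
  then show "root_step G A \<beta> \<gamma>"
    unfolding root_step_def using * \<beta> i simple_refl_involutive[OF i(1), of \<gamma>]
    by (metis Suc_eq_plus1)
qed

lemma root_le_iff:
  assumes "\<gamma> \<in> pos_roots G A"
  shows "root_le G A \<beta> \<gamma> \<longleftrightarrow> descent\<^sup>*\<^sup>* \<gamma> \<beta>"
proof
  assume "root_le G A \<beta> \<gamma>"
  then have "(root_step G A)\<^sup>*\<^sup>* \<beta> \<gamma>" by (simp add: root_le_def)
  then show "descent\<^sup>*\<^sup>* \<gamma> \<beta>"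
    by (induction) (auto simp: root_step_iff intro: converse_rtranclp_into_rtranclp)
next
  assume "descent\<^sup>*\<^sup>* \<gamma> \<beta>"
  then have "\<beta> \<in> pos_roots G A \<and> (root_step G A)\<^sup>*\<^sup>* \<beta> \<gamma>"
  proof (induction)
    case (step \<beta> \<beta>')
    then show ?case
      using descent_pos_roots root_step_iff by (meson converse_rtranclp_into_rtranclp)
  qed (use assms in simp)
  then show "root_le G A \<beta> \<gamma>" using assms by (simp add: root_le_def)
qed

end

section \<open>Stretched lists\<close>

text \<open>A structural form of the multiplicity function in \<open>stretching_class\<close>; it
  can be split wherever the marked list is split.\<close>

inductive stretched :: "'a list \<Rightarrow> 'a list \<Rightarrow> bool" where
  Nil: "stretched [] []"
| Cons: "\<lbrakk>stretched M ys; k > 0\<rbrakk> \<Longrightarrow> stretched (v # M) (replicate k v @ ys)"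

inductive_cases stretched_NilE: "stretched [] ys"
inductive_cases stretched_ConsE: "stretched (v # M) ys"

lemma stretched_Nil_iff [simp]: "stretched [] ys \<longleftrightarrow> ys = []"
  by (auto intro: stretched.Nil elim: stretched_NilE)

lemma stretched_Cons_iff:
  "stretched (v # M) ys \<longleftrightarrow> (\<exists>k zs. k > 0 \<and> stretched M zs \<and> ys = replicate k v @ zs)"
  using stretched_ConsE stretched.Cons by metis

lemma stretched_append_iff:
  "stretched (M @ N) ys \<longleftrightarrow> (\<exists>us vs. ys = us @ vs \<and> stretched M us \<and> stretched N vs)"
proof (induction M arbitrary: ys)
  case (Cons v M)
  show ?case
  proof
    assume "stretched ((v # M) @ N) ys"
    then obtain k zs where k: "k > 0" "stretched (M @ N) zs" "ys = replicate k v @ zs"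
      by (auto simp: stretched_Cons_iff)
    then obtain us vs where "zs = us @ vs" "stretched M us" "stretched N vs"
      using Cons.IH by auto
    then have "ys = (replicate k v @ us) @ vs" "stretched (v # M) (replicate k v @ us)" "stretched N vs"
      using k stretched.Cons by auto
    then show "\<exists>us vs. ys = us @ vs \<and> stretched (v # M) us \<and> stretched N vs" by blast
  next
    assume "\<exists>us vs. ys = us @ vs \<and> stretched (v # M) us \<and> stretched N vs"
    then obtain ws vs where ws: "ys = ws @ vs" "stretched (v # M) ws" "stretched N vs" by blast
    then obtain k us where k: "k > 0" "ws = replicate k v @ us" "stretched M us"
      by (auto simp: stretched_Cons_iff)
    then have "stretched (M @ N) (us @ vs)" using Cons.IH ws(3) by blast
    then show "stretched ((v # M) @ N) ys" using stretched.Cons[OF _ k(1), of "M @ N" "us @ vs" v] ws k by simp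
  qed
qed simp

lemma stretched_appendI: "\<lbrakk>stretched M us; stretched N vs\<rbrakk> \<Longrightarrow> stretched (M @ N) (us @ vs)"
  by (auto simp: stretched_append_iff)

lemma stretched_appendE:
  assumes "stretched (M @ N) ys"
  obtains us vs where "stretched M us" "stretched N vs" "ys = us @ vs"
  using assms by (auto simp: stretched_append_iff)

lemma stretched_Cons1: "stretched M ys \<Longrightarrow> stretched (v # M) (v # ys)"
  using stretched.Cons[of M ys "Suc 0" v] by simp

lemma stretched_singleton_iff: "stretched [v] ys \<longleftrightarrow> (\<exists>k>0. ys = replicate k v)"
  by (auto simp: stretched_Cons_iff)

lemma stretched_rev: "stretched M ys \<Longrightarrow> stretched (rev M) (rev ys)"
  by (induction rule: stretched.induct) (auto simp: stretched_append_iff stretched_singleton_iff)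

lemma stretched_empty_iff: "stretched M ys \<Longrightarrow> ys = [] \<longleftrightarrow> M = []"
  by (induction rule: stretched.induct) auto

lemma stretched_hd: "stretched M ys \<Longrightarrow> M \<noteq> [] \<Longrightarrow> hd ys = hd M"
  by (cases rule: stretched.cases) (auto simp: hd_append)

lemma stretched_last: "stretched M ys \<Longrightarrow> M \<noteq> [] \<Longrightarrow> last ys = last M"
  using stretched_hd[OF stretched_rev, of M ys] stretched_empty_iff[of M ys]
  by (simp add: hd_rev)

lemma stretched_length: "stretched M ys \<Longrightarrow> length M \<le> length ys"
  by (induction rule: stretched.induct) auto

text \<open>The first entry absorbs the surplus length.\<close>

lemma stretched_extend:
  assumes "M \<noteq> []" "length M \<le> n"
  shows "\<exists>ys. stretched M ys \<and> length ys = n"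
proof -
  have refl: "stretched M M" for M :: "'a list"
    by (induction M) (auto simp: stretched_Cons_iff intro!: exI[of _ 1])
  obtain v N where M: "M = v # N" using assms(1) by (cases M) auto
  show ?thesis
    using assms(2) stretched.Cons[OF refl[of N], of "n - length N" v]
    by (intro exI[of _ "replicate (n - length N) v @ N"]) (auto simp: M)
qed

text \<open>Locates a position inside its block: \<open>i\<close> and \<open>j\<close> count the
  copies of the same entry of \<open>M\<close> to its left and right. Whether they vanish tells if a
  reflection hits the interior of a block, an end of it, or a block of length one.\<close>

lemma stretched_hole:
  assumes "stretched M (us @ v # vs)"
  obtains M1 M2 us' vs' i j where "M = M1 @ v # M2" "us = us' @ replicate i v"
    "vs = replicate j v @ vs'" "stretched M1 us'" "stretched M2 vs'"
  using assms
proof (induction M arbitrary: us thesis)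
  case (Cons a M)
  from Cons.prems(2) obtain k zs where k: "k > 0" "stretched M zs" "us @ v # vs = replicate k a @ zs"
    by (auto simp: stretched_Cons_iff)
  show ?case
  proof (cases "length us < k")
    case True
    have "(us @ v # vs) ! length us = a"
      unfolding k(3) using True by (simp add: nth_append)
    then have "a = v" by simp
    have "take (length us) (us @ v # vs) = replicate (length us) a" unfolding k(3) using True by simp
    then obtain n where us: "us = replicate n v" unfolding \<open>a = v\<close> by auto
    have "drop (Suc (length us)) (us @ v # vs) = replicate (k - Suc (length us)) a @ zs"
      unfolding k(3) using True by simp
    then obtain j where "vs = replicate j v @ zs" unfolding \<open>a = v\<close> by auto
    then show ?thesis using Cons.prems(1)[of "[]" M "[]" n j zs] us k(2) \<open>a = v\<close> by simp
  next
    case False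
    then have "take k us = replicate k a" using arg_cong[OF k(3), of "take k"] by simp
    then have us: "us = replicate k a @ drop k us" by (metis append_take_drop_id)
    have "zs = drop k us @ v # vs"
      using arg_cong[OF k(3), of "drop k"] False by simp
    then obtain M1 M2 us' vs' i j where *: "M = M1 @ v # M2" "drop k us = us' @ replicate i v"
      "vs = replicate j v @ vs'" "stretched M1 us'" "stretched M2 vs'"
      using Cons.IH[of "drop k us"] k(2) by blast
    have "stretched (a # M1) (replicate k a @ us')" using stretched.Cons[OF *(4) k(1)] .
    moreover have "us = (replicate k a @ us') @ replicate i v" using us *(2) by (metis append.assoc)
    ultimately show ?thesis using Cons.prems(1)[of "a # M1" M2 "replicate k a @ us'" i j vs'] * by simp
  qed
qed simp

text \<open>Here \<open>distinct\<close> permits setting the multiplicity of one index without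
  disturbing the others.\<close>

lemma stretched_concat_iff:
  "distinct js \<Longrightarrow> stretched (map f js) ys \<longleftrightarrow>
    (\<exists>k. (\<forall>j\<in>set js. 0 < k j) \<and> ys = concat (map (\<lambda>j. replicate (k j) (f j)) js))"
proof (induction js arbitrary: ys)
  case (Cons a js)
  show ?case
  proof
    assume "stretched (map f (a # js)) ys"
    then obtain n zs where n: "n > 0" "stretched (map f js) zs" "ys = replicate n (f a) @ zs"
      by (auto simp: stretched_Cons_iff)
    then obtain k where k: "\<forall>j\<in>set js. 0 < k j" "zs = concat (map (\<lambda>j. replicate (k j) (f j)) js)"
      using Cons by auto
    define k' where "k' = k(a := n)"
    have "k' a = n" "\<forall>j\<in>set js. k' j = k j" using Cons.prems by (auto simp: k'_def)
    then have "(\<forall>j\<in>set (a # js). 0 < k' j) \<and> ys = concat (map (\<lambda>j. replicate (k' j) (f j)) (a # js))"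
      using n k by (auto intro!: arg_cong[of _ _ concat])
    then show "\<exists>k. (\<forall>j\<in>set (a # js). 0 < k j) \<and> ys = concat (map (\<lambda>j. replicate (k j) (f j)) (a # js))"
      by blast
  next
    assume "\<exists>k. (\<forall>j\<in>set (a # js). 0 < k j) \<and> ys = concat (map (\<lambda>j. replicate (k j) (f j)) (a # js))"
    then obtain k where "\<forall>j\<in>set (a # js). 0 < k j"
        "ys = concat (map (\<lambda>j. replicate (k j) (f j)) (a # js))" by blast
    then show "stretched (map f (a # js)) ys"
      using Cons.IH[of "concat (map (\<lambda>j. replicate (k j) (f j)) js)"] Cons.prems
      by (auto intro!: stretched.Cons)
  qed
qed auto

lemma stretched_set: "stretched M ys \<Longrightarrow> set ys = set M"
  by (induction rule: stretched.induct) auto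

section \<open>Counting successive differences of an integer list\<close>

fun count_diffs :: "(int \<Rightarrow> bool) \<Rightarrow> int list \<Rightarrow> int" where
  "count_diffs P (a # b # xs) = (if P (b - a) then 1 else 0) + count_diffs P (b # xs)"
| "count_diffs P _ = 0"

lemma count_diffs_Cons:
  "ys \<noteq> [] \<Longrightarrow> count_diffs P (a # ys) = (if P (hd ys - a) then 1 else 0) + count_diffs P ys"
  by (cases ys) auto

lemma count_diffs_append:
  "\<lbrakk>xs \<noteq> []; ys \<noteq> []\<rbrakk> \<Longrightarrow> count_diffs P (xs @ ys) =
    count_diffs P xs + (if P (hd ys - last xs) then 1 else 0) + count_diffs P ys"
  by (induction xs rule: induct_list012) (auto simp: count_diffs_Cons)

text \<open>The new middle value exchanges the differences on its two sides.\<close>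

lemma count_diffs_reflect:
  assumes "xs \<noteq> []" "ys \<noteq> []"
  shows "count_diffs P (xs @ (last xs + hd ys - v) # ys) = count_diffs P (xs @ v # ys)"
  using assms by (simp add: count_diffs_append count_diffs_Cons)

lemma count_diffs_replace_hd: "count_diffs P (a # xs) \<le> count_diffs P (b # xs) + 1"
  by (cases xs) auto

lemma count_diffs_replace_last: "count_diffs P (xs @ [a]) \<le> count_diffs P (xs @ [b]) + 1"
  by (cases "xs = []") (auto simp: count_diffs_append)

lemma count_diffs_compl: "xs \<noteq> [] \<Longrightarrow>
    count_diffs P xs + count_diffs (\<lambda>d. \<not> P d) xs = int (length xs) - 1"
  by (induction xs rule: induct_list012) auto

lemma count_diffs_mono: "(\<And>d. P d \<Longrightarrow> Q d) \<Longrightarrow> count_diffs P xs \<le> count_diffs Q xs"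
  by (induction xs rule: induct_list012) auto

section \<open>List model of stretching classes\<close>

text \<open>The argument about classes sees the rest of the diagram only through the two end sums
  and the reflected values off the path, so these are kept abstract. \<open>off_value\<close> takes
  the first and the last path value, the only ones that influence a vertex off the path.\<close>

locale path_model =
  fixes V :: "'v set"
    and lsum rsum :: "('v \<Rightarrow> int) \<Rightarrow> int"
    and off_value :: "('v \<Rightarrow> int) \<Rightarrow> 'v \<Rightarrow> int \<Rightarrow> int \<Rightarrow> int"
begin

text \<open>A descent at fixed path length, with the end sums standing beyond the two ends of the
  list. Negative results are excluded here, whereas \<open>list_op\<close> leaves them to the later
  test \<open>nonneg_marked\<close>.\<close>

inductive list_step :: "('v \<Rightarrow> int) \<times> int list \<Rightarrow> ('v \<Rightarrow> int) \<times> int list \<Rightarrow> bool" where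
  off: "\<lbrakk>v \<in> V; c = off_value f v (hd xs) (last xs); 0 \<le> c; c < f v\<rbrakk>
    \<Longrightarrow> list_step (f, xs) (f(v := c), xs)"
| path: "\<lbrakk>c = last (lsum f # us) + hd (vs @ [rsum f]) - v; 0 \<le> c; c < v\<rbrakk>
    \<Longrightarrow> list_step (f, us @ v # vs) (f, us @ c # vs)"

text \<open>\<open>(f, us, M, ws)\<close> is a marked function: \<open>f\<close> off the path, \<open>M\<close> on the marked path vertices,
  \<open>us\<close> and \<open>ws\<close> on the path vertices to their left and right.\<close>

inductive list_op :: "('v \<Rightarrow> int) \<times> int list \<times> int list \<times> int list
    \<Rightarrow> ('v \<Rightarrow> int) \<times> int list \<times> int list \<times> int list \<Rightarrow> bool" where
  off: "\<lbrakk>v \<in> V; c = off_value f v (hd (us @ M)) (last (M @ ws)); c < f v\<rbrakk>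
    \<Longrightarrow> list_op (f, us, M, ws) (f(v := c), us, M, ws)"
| pre: "\<lbrakk>c = last (lsum f # us1) + hd (us2 @ M) - v; c < v\<rbrakk>
    \<Longrightarrow> list_op (f, us1 @ v # us2, M, ws) (f, us1 @ c # us2, M, ws)"
| suf: "\<lbrakk>c = last (M @ ws1) + hd (ws2 @ [rsum f]) - v; c < v\<rbrakk>
    \<Longrightarrow> list_op (f, us, M, ws1 @ v # ws2) (f, us, M, ws1 @ c # ws2)"
| int: "\<lbrakk>c = a + d - v; c < v\<rbrakk>
    \<Longrightarrow> list_op (f, us, M1 @ a # v # d # M2, ws) (f, us, M1 @ a # c # d # M2, ws)"
| insl: "\<lbrakk>c = last (lsum f # us); c < v\<rbrakk>
    \<Longrightarrow> list_op (f, us, v # M, ws) (f, us, c # v # M, ws)"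
| insr: "\<lbrakk>c = hd (ws @ [rsum f]); c < v\<rbrakk>
    \<Longrightarrow> list_op (f, us, M @ [v], ws) (f, us, M @ [v, c], ws)"
| lend: "\<lbrakk>c = last (lsum f # us) + d - v; c < v; c < d\<rbrakk>
    \<Longrightarrow> list_op (f, us, v # d # M, ws) (f, us, c # d # M, ws)"
| lend': "\<lbrakk>c = last (lsum f # us) + d - v; c < v; d \<le> c\<rbrakk>
    \<Longrightarrow> list_op (f, us, v # d # M, ws) (f, us @ [c], d # M, ws)"
| rend: "\<lbrakk>c = a + hd (ws @ [rsum f]) - v; c < v; c < a\<rbrakk>
    \<Longrightarrow> list_op (f, us, M @ [a, v], ws) (f, us, M @ [a, c], ws)"
| rend': "\<lbrakk>c = a + hd (ws @ [rsum f]) - v; c < v; a \<le> c\<rbrakk>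
    \<Longrightarrow> list_op (f, us, M @ [a, v], ws) (f, us, M @ [a], c # ws)"

fun elems :: "('v \<Rightarrow> int) \<times> int list \<times> int list \<times> int list \<Rightarrow> (('v \<Rightarrow> int) \<times> int list) set" where
  "elems (f, us, M, ws) = {(f, us @ ys @ ws) | ys. stretched M ys}"

lemma elemsI: "\<lbrakk>stretched M ys; xs = us @ ys @ ws\<rbrakk> \<Longrightarrow> (f, xs) \<in> elems (f, us, M, ws)"
  by auto

text \<open>Between a left neighbour \<open>c\<close> and a right neighbour \<open>d\<close> the
  value \<open>d\<close> reflects to \<open>c + d - d = c\<close>. The \<open>k > 0\<close> copies
  that stay behind provide the right neighbour for the last reflection too.\<close>

lemma spread_right:
  assumes "last (lsum f # us) = c" "0 \<le> c" "c < d" "k > 0"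
  shows "list_step\<^sup>*\<^sup>* (f, us @ replicate (i + k) d @ vs) (f, us @ replicate i c @ replicate k d @ vs)"
  using assms(1)
proof (induction i arbitrary: us)
  case (Suc i)
  have "list_step (f, us @ d # (replicate (i + k) d @ vs)) (f, us @ c # (replicate (i + k) d @ vs))"
    using Suc.prems assms(2-4) by (intro list_step.path) (auto simp: hd_append)
  also have "list_step\<^sup>*\<^sup>* \<dots> (f, (us @ [c]) @ replicate i c @ replicate k d @ vs)"
    using Suc.IH[of "us @ [c]"] by simp
  finally show ?case by simp
qed simp

lemma spread_left:
  assumes "hd (vs @ [rsum f]) = c" "0 \<le> c" "c < d" "k > 0"
  shows "list_step\<^sup>*\<^sup>* (f, us @ replicate (k + i) d @ vs) (f, us @ replicate k d @ replicate i c @ vs)"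
  using assms(1)
proof (induction i arbitrary: vs)
  case (Suc i)
  have "list_step (f, (us @ replicate (k + i) d) @ d # vs) (f, (us @ replicate (k + i) d) @ c # vs)"
    using Suc.prems assms(2-4) by (intro list_step.path) (auto simp: last_append)
  also have "list_step\<^sup>*\<^sup>* \<dots> (f, us @ replicate k d @ replicate i c @ c # vs)"
    using Suc.IH[of "c # vs"] by simp
  finally show ?case by (simp add: replicate_app_Cons_same)
qed simp

lemma stretched_hd_append: "stretched M ys \<Longrightarrow> M \<noteq> [] \<Longrightarrow> hd (us @ ys @ vs) = hd (us @ M)"
  using stretched_hd[of M ys] stretched_empty_iff[of M ys] by (auto simp: hd_append)

lemma stretched_last_append: "stretched M ys \<Longrightarrow> M \<noteq> [] \<Longrightarrow> last (us @ ys @ vs) = last (M @ vs)"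
  using stretched_last[of M ys] stretched_empty_iff[of M ys] by (auto simp: last_append)

text \<open>The source element is chosen so that a reflected entry occurs in it only once; further
  copies of the new value are taken from an adjacent block of larger value, through which the new
  value spreads. For an insertion that block is the one of the old endpoint.\<close>

lemma elems_reachable:
  assumes "list_op C C'" "fst (snd (snd C)) \<noteq> []" "s' \<in> elems C'" "\<forall>v\<in>V. 0 \<le> fst s' v" "\<forall>c\<in>set (snd s'). 0 \<le> c"
  shows "\<exists>s\<in>elems C. length (snd s) = length (snd s') \<and> list_step\<^sup>*\<^sup>* s s'"
  using assms
proof (cases rule: list_op.cases)
  case (off v c f us M ws)
  from assms(3) off obtain ys where ys: "s' = (f(v := c), us @ ys @ ws)" "stretched M ys" by auto
  have "list_step (f, us @ ys @ ws) s'" unfolding ys(1)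
    using assms(2,4) off ys
    by (intro list_step.off) (auto simp: stretched_hd_append stretched_last_append)
  then show ?thesis using off ys by (intro bexI[of _ "(f, us @ ys @ ws)"]) auto
next
  case (pre c f us1 us2 M v ws)
  from assms(3) pre obtain ys where ys: "s' = (f, us1 @ c # us2 @ ys @ ws)" "stretched M ys" by auto
  have "list_step (f, us1 @ v # us2 @ ys @ ws) s'" unfolding ys(1)
    using assms(2,5) pre ys
    by (intro list_step.path) (auto simp: stretched_hd_append)
  then show ?thesis using pre ys by (intro bexI[of _ "(f, us1 @ v # us2 @ ys @ ws)"]) auto
next
  case (suf c M ws1 ws2 f v us)
  from assms(3) suf obtain ys where ys: "s' = (f, us @ ys @ ws1 @ c # ws2)" "stretched M ys" by auto
  have "last (lsum f # us @ ys @ ws1) = last (M @ ws1)"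
    using stretched_last_append[OF ys(2), of "lsum f # us" ws1] assms(2) suf by simp
  then have "list_step (f, (us @ ys @ ws1) @ v # ws2) (f, (us @ ys @ ws1) @ c # ws2)"
    using assms(5) suf ys by (intro list_step.path) auto
  then show ?thesis using suf ys by (intro bexI[of _ "(f, us @ ys @ ws1 @ v # ws2)"]) auto
next
  case (int c a d v f us M1 M2 ws)
  from assms(3) int obtain ys where ys: "s' = (f, us @ ys @ ws)" "stretched (M1 @ a # c # d # M2) ys"
    by auto
  from ys(2) obtain y1 y2 ka kc' kd where ys': "ys = y1 @ replicate ka a @ replicate kc' c @ replicate kd d @ y2"
    and y: "stretched M1 y1" "stretched M2 y2" "ka > 0" "kc' > 0" "kd > 0"
    by (elim stretched_appendE stretched_ConsE) simp
  obtain kc where "kc' = Suc kc" using y(4) gr0_implies_Suc by blast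
  then have s': "s' = (f, us @ y1 @ replicate ka a @ replicate (Suc kc) c @ replicate kd d @ y2 @ ws)"
    using ys(1) ys' by simp
  have c0: "0 \<le> c" using assms(5) unfolding s' by simp
  show ?thesis
  \<comment> \<open>If \<open>a < v\<close> then \<open>c < d\<close>, and the extra copies of
    \<open>c\<close> come out of the block of \<open>d\<close>. Otherwise
    \<open>c < v \<le> a\<close>, and they come out of the block of \<open>a\<close>.\<close>
  proof (cases "a < v")
    case True
    let ?s = "(f, (us @ y1 @ replicate ka a) @ v # (replicate (kc + kd) d @ y2 @ ws))"
    have "list_step ?s (f, (us @ y1 @ replicate ka a) @ c # (replicate (kc + kd) d @ y2 @ ws))"
      using c0 y int by (intro list_step.path) (auto simp: last_append hd_append)
    also have "list_step\<^sup>*\<^sup>* \<dots> s'"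
      using spread_right[of f "us @ y1 @ replicate ka a @ [c]" c d kd kc "y2 @ ws"] c0 y int True
      unfolding s' by simp
    finally have "list_step\<^sup>*\<^sup>* ?s s'" .
    moreover have "stretched (M1 @ a # v # d # M2) (y1 @ replicate ka a @ v # replicate (kc + kd) d @ y2)"
      using y by (intro stretched_appendI stretched.Cons stretched_Cons1) auto
    then have "?s \<in> elems C" unfolding int by (rule elemsI) simp
    ultimately show ?thesis by (intro bexI[of _ ?s] conjI) (simp_all add: s')
  next
    case False
    let ?s = "(f, (us @ y1 @ replicate (ka + kc) a) @ v # (replicate kd d @ y2 @ ws))"
    have "list_step ?s (f, (us @ y1 @ replicate (ka + kc) a) @ c # (replicate kd d @ y2 @ ws))"
      using c0 y int by (intro list_step.path) (auto simp: last_append hd_append)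
    also have "list_step\<^sup>*\<^sup>* \<dots> s'"
      using spread_left[of "c # replicate kd d @ y2 @ ws" f c a ka "us @ y1" kc] c0 y int False
      unfolding s' by (simp add: replicate_app_Cons_same)
    finally have "list_step\<^sup>*\<^sup>* ?s s'" .
    moreover have "stretched (M1 @ a # v # d # M2) (y1 @ replicate (ka + kc) a @ v # replicate kd d @ y2)"
      using y by (intro stretched_appendI stretched.Cons stretched_Cons1) auto
    then have "?s \<in> elems C" unfolding int by (rule elemsI) simp
    ultimately show ?thesis by (intro bexI[of _ ?s] conjI) (simp_all add: s')
  qed
next
  case (insl c f us v M ws)
  from assms(3) insl obtain zs where zs: "s' = (f, us @ zs @ ws)" "stretched (c # v # M) zs" by auto
  from zs(2) obtain ys kc k where "zs = replicate kc c @ replicate k v @ ys"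
    and y: "stretched M ys" "k > 0" "kc > 0"
    by (elim stretched_ConsE) simp
  then have s': "s' = (f, us @ replicate kc c @ replicate k v @ ys @ ws)" using zs by simp
  have c0: "0 \<le> c" using assms(5) y unfolding s' by simp
  have "list_step\<^sup>*\<^sup>* (f, us @ replicate (kc + k) v @ ys @ ws) s'"
    using spread_right[of f us c v k kc "ys @ ws"] c0 insl y unfolding s' by simp
  moreover have "(f, us @ replicate (kc + k) v @ ys @ ws) \<in> elems C"
    unfolding insl by (rule elemsI[OF stretched.Cons[OF y(1), of "kc + k" v]]) (use y in simp_all)
  ultimately show ?thesis by (metis (no_types, lifting) s' length_append length_replicate snd_conv add.assoc)
next
  case (insr c ws f v us M)
  from assms(3) insr obtain zs where zs: "s' = (f, us @ zs @ ws)" "stretched (M @ [v, c]) zs" by auto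
  from zs(2) obtain ys kc k where "zs = ys @ replicate k v @ replicate kc c"
    and y: "stretched M ys" "k > 0" "kc > 0"
    by (elim stretched_appendE stretched_ConsE stretched_NilE) simp
  then have s': "s' = (f, us @ ys @ replicate k v @ replicate kc c @ ws)" using zs by simp
  have c0: "0 \<le> c" using assms(5) y unfolding s' by simp
  have "list_step\<^sup>*\<^sup>* (f, (us @ ys) @ replicate (k + kc) v @ ws) s'"
    using spread_left[of ws f c v k "us @ ys" kc] c0 insr y unfolding s' by simp
  moreover have "(f, (us @ ys) @ replicate (k + kc) v @ ws) \<in> elems C"
    unfolding insr
    by (rule elemsI[OF stretched_appendI[OF y(1) stretched.Cons[OF stretched.Nil, of "k + kc" v]]])
      (use y in simp_all)
  ultimately show ?thesis by (metis (no_types, lifting) s' length_append length_replicate snd_conv add.assoc)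
next
  case (lend c f us d v M ws)
  from assms(3) lend obtain zs where zs: "s' = (f, us @ zs @ ws)" "stretched (c # d # M) zs" by auto
  from zs(2) obtain ys kc' k where zs': "zs = replicate kc' c @ replicate k d @ ys"
    and y: "stretched M ys" "k > 0" "kc' > 0"
    by (elim stretched_ConsE) simp
  then obtain kc where "kc' = Suc kc" using gr0_implies_Suc by blast
  then have s': "s' = (f, us @ replicate (Suc kc) c @ replicate k d @ ys @ ws)" using zs zs' by simp
  have c0: "0 \<le> c" using assms(5) y unfolding s' by simp
  let ?s = "(f, us @ v # (replicate (kc + k) d @ ys @ ws))"
  have "list_step ?s (f, us @ c # (replicate (kc + k) d @ ys @ ws))"
    using c0 y lend by (intro list_step.path) (auto simp: hd_append)
  also have "list_step\<^sup>*\<^sup>* \<dots> s'"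
    using spread_right[of f "us @ [c]" c d k kc "ys @ ws"] c0 lend y unfolding s' by simp
  finally have "list_step\<^sup>*\<^sup>* ?s s'" .
  moreover have "?s \<in> elems C"
    unfolding lend
    by (rule elemsI[OF stretched_Cons1[OF stretched.Cons[OF y(1), of "kc + k" d]]]) (use y in simp_all)
  ultimately show ?thesis by (intro bexI[of _ ?s] conjI) (simp_all add: s')
next
  case (lend' c f us d v M ws)
  from assms(3) lend' obtain zs where zs: "s' = (f, us @ c # zs @ ws)" "stretched (d # M) zs" by auto
  from zs(2) obtain ys k where "zs = replicate k d @ ys" and y: "stretched M ys" "k > 0"
    by (elim stretched_ConsE) simp
  then have s': "s' = (f, us @ c # replicate k d @ ys @ ws)" using zs by simp
  have c0: "0 \<le> c" using assms(5) y unfolding s' by simp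
  \<comment> \<open>Since \<open>d \<le> c\<close>, the value \<open>c\<close> cannot spread into
    the block of \<open>d\<close>. It occurs exactly once, which is why the operation removes its
    mark.\<close>
  let ?s = "(f, us @ v # (replicate k d @ ys @ ws))"
  have "list_step ?s s'" unfolding s'
    using c0 y lend' by (intro list_step.path) (auto simp: hd_append)
  moreover have "?s \<in> elems C"
    unfolding lend'
    by (rule elemsI[OF stretched_Cons1[OF stretched.Cons[OF y(1), of k d]]]) (use y in simp_all)
  ultimately show ?thesis by (intro bexI[of _ ?s] conjI) (simp_all add: s')
next
  case (rend c a ws f v us M)
  from assms(3) rend obtain zs where zs: "s' = (f, us @ zs @ ws)" "stretched (M @ [a, c]) zs" by auto
  from zs(2) obtain ys kc' k where zs': "zs = ys @ replicate k a @ replicate kc' c"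
    and y: "stretched M ys" "k > 0" "kc' > 0"
    by (elim stretched_appendE stretched_ConsE stretched_NilE) simp
  then obtain kc where "kc' = Suc kc" using gr0_implies_Suc by blast
  then have s': "s' = (f, us @ ys @ replicate k a @ replicate (Suc kc) c @ ws)" using zs zs' by simp
  have c0: "0 \<le> c" using assms(5) y unfolding s' by simp
  let ?s = "(f, (us @ ys @ replicate (k + kc) a) @ v # ws)"
  have "list_step ?s (f, (us @ ys @ replicate (k + kc) a) @ c # ws)"
    using c0 y rend by (intro list_step.path) (auto simp: last_append)
  also have "list_step\<^sup>*\<^sup>* \<dots> s'"
    using spread_left[of "c # ws" f c a k "us @ ys" kc] c0 rend y
    unfolding s' by (simp add: replicate_app_Cons_same)
  finally have "list_step\<^sup>*\<^sup>* ?s s'" .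
  moreover have "?s \<in> elems C"
    unfolding rend
    by (rule elemsI[OF stretched_appendI[OF y(1)
            stretched.Cons[OF stretched_Cons1[OF stretched.Nil], of "k + kc" a]]])
      (use y in simp_all)
  ultimately show ?thesis by (intro bexI[of _ ?s] conjI) (simp_all add: s')
next
  case (rend' c a ws f v us M)
  from assms(3) rend' obtain zs where zs: "s' = (f, us @ zs @ c # ws)" "stretched (M @ [a]) zs" by auto
  from zs(2) obtain ys k where "zs = ys @ replicate k a" and y: "stretched M ys" "k > 0"
    by (elim stretched_appendE stretched_ConsE stretched_NilE) simp
  then have s': "s' = (f, us @ ys @ replicate k a @ c # ws)" using zs by simp
  have c0: "0 \<le> c" using assms(5) y unfolding s' by simp
  let ?s = "(f, (us @ ys @ replicate k a) @ v # ws)"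
  have "list_step ?s (f, (us @ ys @ replicate k a) @ c # ws)"
    using c0 y rend' by (intro list_step.path) (auto simp: last_append)
  moreover have "?s \<in> elems C"
    unfolding rend'
    by (rule elemsI[OF stretched_appendI[OF y(1)
            stretched.Cons[OF stretched_Cons1[OF stretched.Nil], of k a]]])
      (use y in simp_all)
  ultimately show ?thesis by (intro bexI[of _ ?s] conjI) (simp_all add: s')
qed

text \<open>Between two copies of its own value a path vertex does not decrease. At one end of a
  block the new value is the one next to the block: a block boundary moves and the class stays, or
  the marked part ends there and this is an insertion. A block of length one is reflected as a
  single entry. \<open>long\<close> excludes the one case without a matching operation, a sole
  marked entry occurring once.\<close>

lemma elems_list_step:
  assumes "list_step s s'" "s \<in> elems C" "C = (f, us, M, ws)" "M \<noteq> []"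
    and long: "length M = 1 \<Longrightarrow> length (us @ M @ ws) < length (snd s)"
  shows "\<exists>C'. (C' = C \<or> list_op C C') \<and> s' \<in> elems C'"
proof -
  from assms(2,3) obtain ys where ys: "s = (f, us @ ys @ ws)" "stretched M ys" by auto
  from assms(1) show ?thesis
  proof (cases rule: list_step.cases)
    case (off v c f' xs)
    then have "list_op C (f(v := c), us, M, ws)"
      using ys assms(3,4) by (auto intro!: list_op.off simp: stretched_hd_append stretched_last_append)
    moreover have "s' \<in> elems (f(v := c), us, M, ws)" using off ys by auto
    ultimately show ?thesis by blast
  next
    case (path c f' us' vs' v)
    then have eq: "us @ ys @ ws = us' @ v # vs'" and f': "f' = f" using ys by auto
    have c: "c = last (lsum f # us') + hd (vs' @ [rsum f]) - v" "c < v"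
      and s': "s' = (f, us' @ c # vs')" using path f' by auto
    consider (1) zs where "us = us' @ v # zs" "vs' = zs @ ys @ ws"
      | (2) zs1 zs2 where "ys = zs1 @ v # zs2" "us' = us @ zs1" "vs' = zs2 @ ws"
      | (3) zs where "ws = zs @ v # vs'" "us' = us @ ys @ zs"
    proof -
      from eq have "(\<exists>zs. us = us' @ v # zs \<and> vs' = zs @ ys @ ws) \<or>
        (\<exists>t. us' = us @ t \<and> ys @ ws = t @ v # vs')"
        by (auto simp: append_eq_append_conv2 append_eq_Cons_conv Cons_eq_append_conv)
      moreover have "(\<exists>zs2. ys = t @ v # zs2 \<and> vs' = zs2 @ ws) \<or> (\<exists>zs. ws = zs @ v # vs' \<and> t = ys @ zs)"
        if "ys @ ws = t @ v # vs'" for t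
        using that by (auto simp: append_eq_append_conv2 append_eq_Cons_conv Cons_eq_append_conv)
      ultimately show thesis using that by blast
    qed
    then show ?thesis
    proof cases
      case 1
      have "list_op (f, us' @ v # zs, M, ws) (f, us' @ c # zs, M, ws)"
        using c 1 ys(2) assms(4) by (intro list_op.pre) (auto simp: stretched_hd_append)
      moreover have "s' \<in> elems (f, us' @ c # zs, M, ws)" using s' 1 ys(2) by auto
      ultimately show ?thesis using assms(3) 1 by blast
    next
      case 3
      have "last (lsum f # us @ ys @ zs) = last (M @ zs)"
        using stretched_last_append[OF ys(2), of "lsum f # us" zs] assms(4) by simp
      then have "list_op (f, us, M, zs @ v # vs') (f, us, M, zs @ c # vs')"
        using c 3 by (intro list_op.suf) auto
      moreover have "s' \<in> elems (f, us, M, zs @ c # vs')" using s' 3 ys(2) by auto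
      ultimately show ?thesis using assms(3) 3 by blast
    next
      case 2
      obtain M1 M2 y1 y2 i j where M: "M = M1 @ v # M2" "stretched M1 y1" "stretched M2 y2"
        and z: "zs1 = y1 @ replicate i v" "zs2 = replicate j v @ y2"
        using stretched_hole ys(2) 2(1) by metis
      have s': "s' = (f, us @ y1 @ replicate i v @ c # replicate j v @ y2 @ ws)"
        using s' 2 z by simp
      have l: "last (lsum f # us') = (if i > 0 then v else if M1 = [] then last (lsum f # us) else last M1)"
        using 2(2) z stretched_last[OF M(2)] stretched_empty_iff[OF M(2)]
        by (auto simp: last_append)
      have r: "hd (vs' @ [rsum f]) = (if j > 0 then v else if M2 = [] then hd (ws @ [rsum f]) else hd M2)"
        using 2(3) z stretched_hd[OF M(3)] stretched_empty_iff[OF M(3)]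
        by (auto simp: hd_append)
      consider (ij) "i > 0" "j > 0" | (i) "i > 0" "j = 0" | (j) "i = 0" "j > 0" | (none) "i = 0" "j = 0"
        by auto
      then show ?thesis
      proof cases
        case ij
        then show ?thesis using c l r by simp
      next
        case j
        have st: "stretched (v # M2) (replicate j v @ y2)" using stretched.Cons[OF M(3) j(2)] .
        have cl: "c = (if M1 = [] then last (lsum f # us) else last M1)" using c l r j by simp
        show ?thesis
        proof (cases "M1 = []")
          case True
          have "list_op C (f, us, c # v # M2, ws)"
            unfolding assms(3) M True using cl c(2) True by (auto intro: list_op.insl)
          moreover have "s' \<in> elems (f, us, c # v # M2, ws)"
            unfolding s' by (rule elemsI[OF stretched_Cons1[OF st]]) (use j M True in simp)
          ultimately show ?thesis by blast
        next
          case False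
          then obtain N where N: "M1 = N @ [c]" using cl by (metis append_butlast_last_id)
          obtain y' k where y': "stretched N y'" "y1 = y' @ replicate k c" "k > 0"
            using M(2) unfolding N by (elim stretched_appendE stretched_ConsE stretched_NilE) simp
          have "stretched ((N @ [c]) @ v # M2) ((y' @ replicate (Suc k) c @ []) @ replicate j v @ y2)"
            by (intro stretched_appendI st y' stretched.Cons stretched.Nil) simp
          then have "s' \<in> elems C" unfolding s' assms(3) M N
            by (rule elemsI) (use y' j in \<open>simp add: replicate_app_Cons_same\<close>)
          then show ?thesis by blast
        qed
      next
        case i
        have st: "stretched [v] (replicate i v @ [])" using stretched.Cons[OF stretched.Nil i(1)] .
        have cr: "c = (if M2 = [] then hd (ws @ [rsum f]) else hd M2)" using c l r i by simp
        show ?thesis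
        proof (cases "M2 = []")
          case True
          have "list_op C (f, us, M1 @ [v, c], ws)"
            unfolding assms(3) M True using cr c(2) True by (auto intro: list_op.insr)
          moreover have "stretched (M1 @ [v, c]) (y1 @ replicate i v @ c # [])"
            by (intro stretched_appendI stretched.Cons stretched_Cons1 stretched.Nil M i)
          then have "s' \<in> elems (f, us, M1 @ [v, c], ws)"
            unfolding s' by (rule elemsI) (use i M True in simp)
          ultimately show ?thesis by blast
        next
          case False
          then obtain N where N: "M2 = c # N" using cr by (metis list.exhaust_sel)
          obtain y' k where y': "stretched N y'" "y2 = replicate k c @ y'" "k > 0"
            using M(3) unfolding N by (elim stretched_ConsE) simp
          have "stretched (M1 @ v # c # N) (y1 @ replicate i v @ replicate (Suc k) c @ y')"
            by (intro stretched_appendI M i y' stretched.Cons stretched.Nil) simp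
          then have "s' \<in> elems C" unfolding s' assms(3) M N
            by (rule elemsI) (use y' i in simp)
          then show ?thesis by blast
        qed
      next
        case none
        have s': "s' = (f, us @ (y1 @ c # y2) @ ws)" using s' none by simp
        consider (single) "M1 = []" "M2 = []" | (left) d N where "M1 = []" "M2 = d # N"
          | (right) a N where "M1 = N @ [a]" "M2 = []"
          | (inner) a d N1 N2 where "M1 = N1 @ [a]" "M2 = d # N2"
          by (metis list.exhaust rev_exhaust)
        then show ?thesis
        proof cases
          case single
          then have "ys = [v]" using 2 z M none by simp
          then show ?thesis using long M single ys(1) by simp
        next
          case left
          have c': "c = last (lsum f # us) + d - v" using c(1) l r none left by simp
          have y1: "y1 = []" using M(2) left by simp
          show ?thesis
          proof (cases "c < d")
            case True
            then have "list_op C (f, us, c # d # N, ws)"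
              unfolding assms(3) M left using c' c(2) list_op.lend[of c f us d v N ws] by simp
            moreover have "s' \<in> elems (f, us, c # d # N, ws)"
              unfolding s' y1 by (rule elemsI[OF stretched_Cons1[OF M(3)[unfolded left]]]) simp
            ultimately show ?thesis by blast
          next
            case False
            then have "list_op C (f, us @ [c], d # N, ws)"
              unfolding assms(3) M left using c' c(2) list_op.lend'[of c f us d v N ws] by simp
            moreover have "s' \<in> elems (f, us @ [c], d # N, ws)"
              unfolding s' y1 by (rule elemsI[OF M(3)[unfolded left]]) simp
            ultimately show ?thesis by blast
          qed
        next
          case right
          have c': "c = a + hd (ws @ [rsum f]) - v" using c(1) l r none right by simp
          have y2: "y2 = []" using M(3) right by simp
          show ?thesis
          proof (cases "c < a")
            case True
            have "list_op C (f, us, (N @ [a]) @ [c], ws)"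
              unfolding assms(3) M right using c' c(2) True list_op.rend[of c a ws f v us N] by simp
            moreover have "stretched ((N @ [a]) @ [c]) (y1 @ [c])"
              using M(2) right by (intro stretched_appendI stretched_Cons1 stretched.Nil) simp
            then have "s' \<in> elems (f, us, (N @ [a]) @ [c], ws)"
              unfolding s' y2 by (rule elemsI) simp
            ultimately show ?thesis by blast
          next
            case False
            then have "list_op C (f, us, N @ [a], c # ws)"
              unfolding assms(3) M right using c' c(2) list_op.rend'[of c a ws f v us N] by simp
            moreover have "s' \<in> elems (f, us, N @ [a], c # ws)"
              unfolding s' y2 by (rule elemsI[OF M(2)[unfolded right]]) simp
            ultimately show ?thesis by blast
          qed
        next
          case inner
          have "c = a + d - v" using c(1) l r none inner by simp
          then have "list_op C (f, us, (N1 @ [a]) @ c # d # N2, ws)"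
            unfolding assms(3) M inner using c(2) list_op.int[of c a d v f us N1 N2 ws] by simp
          moreover have "stretched ((N1 @ [a]) @ c # d # N2) (y1 @ c # y2)"
            using M(2,3) inner by (intro stretched_appendI stretched_Cons1) auto
          then have "s' \<in> elems (f, us, (N1 @ [a]) @ c # d # N2, ws)"
            unfolding s' by (rule elemsI) simp
          ultimately show ?thesis by blast
        qed
      qed
    qed
  qed
qed

text \<open>A reflection at a path vertex swaps two adjacent differences, an insertion adds a zero
  difference, and a reflection off the path changes only the first and the last difference but
  lowers \<open>sum f V\<close>.\<close>

fun counts_bounded :: "int \<Rightarrow> ('v \<Rightarrow> int) \<times> int list \<times> int list \<times> int list \<Rightarrow> bool" where
  "counts_bounded t (f, us, M, ws) \<longleftrightarrow>
     count_diffs (\<lambda>d. d \<noteq> 0) (lsum f # us @ M @ ws @ [rsum f]) + 2 * sum f V \<le> 2 + 2 * t \<and>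
     count_diffs (\<lambda>d. d \<ge> 0) (lsum f # us @ [hd M]) + sum f V \<le> 1 + t \<and>
     count_diffs (\<lambda>d. d \<le> 0) (last M # ws @ [rsum f]) + sum f V \<le> 1 + t"

text \<open>A reflection off the path can add two to the first count, one at either end, but only
  one to each of the others, and it lowers the sum by at least one; this explains the weights 2 and
  1. Initially there are two differences, one on either side of the mark, which gives the additive
  constants.\<close>

lemma list_op_counts_bounded:
  assumes "list_op C C'" "counts_bounded t C" "fst (snd (snd C)) \<noteq> []" "finite V"
  shows "counts_bounded t C'"
  using assms
proof (cases rule: list_op.cases)
  case (off v c f us M ws)
  have "sum (f(v := c)) V = sum f V + (c - f v)"
    using off(3) assms(4) by (simp add: sum.remove[of V v] )
  then have s: "sum (f(v := c)) V \<le> sum f V - 1" using off by simp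
  let ?P = "\<lambda>d::int. d \<noteq> 0" and ?f = "f(v := c)"
  have "count_diffs ?P (lsum ?f # us @ M @ ws @ [rsum ?f]) \<le>
      count_diffs ?P (lsum f # us @ M @ ws @ [rsum ?f]) + 1"
    by (rule count_diffs_replace_hd)
  also have "count_diffs ?P (lsum f # us @ M @ ws @ [rsum ?f]) \<le>
      count_diffs ?P (lsum f # us @ M @ ws @ [rsum f]) + 1"
    using count_diffs_replace_last[of ?P "lsum f # us @ M @ ws"] by simp
  finally have 1: "count_diffs ?P (lsum ?f # us @ M @ ws @ [rsum ?f]) \<le>
      count_diffs ?P (lsum f # us @ M @ ws @ [rsum f]) + 2" by simp
  have 2: "count_diffs (\<lambda>d. d \<ge> 0) (lsum ?f # us @ [hd M]) \<le>
      count_diffs (\<lambda>d. d \<ge> 0) (lsum f # us @ [hd M]) + 1"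
    by (rule count_diffs_replace_hd)
  have 3: "count_diffs (\<lambda>d. d \<le> 0) (last M # ws @ [rsum ?f]) \<le>
      count_diffs (\<lambda>d. d \<le> 0) (last M # ws @ [rsum f]) + 1"
    using count_diffs_replace_last[of "\<lambda>d. d \<le> 0" "last M # ws"] by simp
  show ?thesis using s 1 2 3 assms(2) unfolding off by (simp del: fun_upd_apply)
next
  case (pre c f us1 us2 M v ws)
  have M: "M \<noteq> []" using assms(3) pre by simp
  have "hd (us2 @ M) = hd (us2 @ M @ ws @ [rsum f])" "hd (us2 @ M) = hd (us2 @ [hd M])"
    using M by (auto simp: hd_append)
  then show ?thesis
    using assms(2) pre count_diffs_reflect[of "lsum f # us1" "us2 @ M @ ws @ [rsum f]" "\<lambda>d. d \<noteq> 0" v]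
      count_diffs_reflect[of "lsum f # us1" "us2 @ [hd M]" "\<lambda>d. d \<ge> 0" v] by simp
next
  case (suf c M ws1 ws2 f v us)
  have M: "M \<noteq> []" using assms(3) suf by simp
  have "last (M @ ws1) = last (lsum f # us @ M @ ws1)" "last (M @ ws1) = last (last M # ws1)"
    using M by (auto simp: last_append)
  then show ?thesis
    using assms(2) suf count_diffs_reflect[of "lsum f # us @ M @ ws1" "ws2 @ [rsum f]" "\<lambda>d. d \<noteq> 0" v]
      count_diffs_reflect[of "last M # ws1" "ws2 @ [rsum f]" "\<lambda>d. d \<le> 0" v] by simp
next
  case (int c a d v f us M1 M2 ws)
  then show ?thesis
    using assms(2) count_diffs_reflect[of "lsum f # us @ M1 @ [a]" "d # M2 @ ws @ [rsum f]" "\<lambda>d. d \<noteq> 0" v]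
    by (auto simp: hd_append)
next
  case (insl c f us v M ws)
  have "count_diffs P ((lsum f # us) @ c # v # M @ ws @ [rsum f]) =
      count_diffs P ((lsum f # us) @ v # M @ ws @ [rsum f]) + (if P 0 then 1 else 0)" for P
    using insl by (simp add: count_diffs_append count_diffs_Cons del: append_Cons last.simps)
  \<comment> \<open>The difference into the leftmost marked entry was positive and is now zero, so
    it is counted before and after; the positive one has moved inside the marks.\<close>
  moreover have "count_diffs (\<lambda>d. d \<ge> 0) ((lsum f # us) @ [c]) = count_diffs (\<lambda>d. d \<ge> 0) ((lsum f # us) @ [v])"
    using insl by (simp add: count_diffs_append del: append_Cons last.simps)
  ultimately show ?thesis using assms(2) insl(1,2) by simp
next
  case (insr c ws f v us M)
  have "count_diffs P ((lsum f # us @ M @ [v]) @ c # (ws @ [rsum f])) =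
      count_diffs P ((lsum f # us @ M @ [v]) @ (ws @ [rsum f])) + (if P 0 then 1 else 0)" for P
    using insr(3) by (simp add: count_diffs_append count_diffs_Cons del: append_Cons append_assoc)
  moreover have "count_diffs (\<lambda>d. d \<le> 0) (c # (ws @ [rsum f])) = count_diffs (\<lambda>d. d \<le> 0) (v # (ws @ [rsum f]))"
    using insr(3,4) by (simp add: count_diffs_Cons)
  ultimately show ?thesis using assms(2) insr(1,2) by (cases "M = []") simp_all
next
  case (lend c f us d v M ws)
  have "count_diffs P (lsum f # us @ c # d # M @ ws @ [rsum f]) =
      count_diffs P (lsum f # us @ v # d # M @ ws @ [rsum f])" for P
    using lend(3) count_diffs_reflect[of "lsum f # us" "d # M @ ws @ [rsum f]" P v] by simp
  \<comment> \<open>\<open>c < d\<close> says that the left neighbour lies below \<open>v\<close>,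
    so the old difference into \<open>v\<close> was counted already.\<close>
  moreover have "count_diffs (\<lambda>d. d \<ge> 0) ((lsum f # us) @ [c]) \<le> count_diffs (\<lambda>d. d \<ge> 0) ((lsum f # us) @ [v])"
    using lend by (simp add: count_diffs_append del: append_Cons last.simps)
  ultimately show ?thesis using assms(2) lend(1,2) by simp
next
  case (lend' c f us d v M ws)
  have "count_diffs P (lsum f # us @ c # d # M @ ws @ [rsum f]) =
      count_diffs P (lsum f # us @ v # d # M @ ws @ [rsum f])" for P
    using lend'(3) count_diffs_reflect[of "lsum f # us" "d # M @ ws @ [rsum f]" P v] by simp
  \<comment> \<open>Here \<open>d \<le> c < v\<close>, so the difference into \<open>c\<close>,
    which equals \<open>d - v\<close>, is negative and not counted; the one from \<open>c\<close> to
    \<open>d\<close> equals the old difference into \<open>v\<close>.\<close>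
  moreover have "count_diffs (\<lambda>d. d \<ge> 0) ((lsum f # us) @ [c, d]) = count_diffs (\<lambda>d. d \<ge> 0) ((lsum f # us) @ [v])"
    using lend' by (simp add: count_diffs_append del: append_Cons last.simps)
  ultimately show ?thesis using assms(2) lend'(1,2) by simp
next
  case (rend c a ws f v us M)
  have "count_diffs P (lsum f # us @ M @ a # c # ws @ [rsum f]) =
      count_diffs P (lsum f # us @ M @ a # v # ws @ [rsum f])" for P
    using rend(3) count_diffs_reflect[of "lsum f # us @ M @ [a]" "ws @ [rsum f]" P v] by simp
  moreover have "count_diffs (\<lambda>d. d \<le> 0) (c # (ws @ [rsum f])) \<le> count_diffs (\<lambda>d. d \<le> 0) (v # (ws @ [rsum f]))"
    using rend(3-5) by (simp add: count_diffs_Cons)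
  ultimately show ?thesis using assms(2) rend(1,2) by (cases "M = []") simp_all
next
  case (rend' c a ws f v us M)
  have "count_diffs P (lsum f # us @ M @ a # c # ws @ [rsum f]) =
      count_diffs P (lsum f # us @ M @ a # v # ws @ [rsum f])" for P
    using rend'(3) count_diffs_reflect[of "lsum f # us @ M @ [a]" "ws @ [rsum f]" P v] by simp
  moreover have "count_diffs (\<lambda>d. d \<le> 0) (a # c # (ws @ [rsum f])) = count_diffs (\<lambda>d. d \<le> 0) (v # (ws @ [rsum f]))"
    using rend'(3-5) by (simp add: count_diffs_Cons)
  ultimately show ?thesis using assms(2) rend'(1,2) by (cases "M = []") simp_all
qed

text \<open>With one mark there are \<open>length us + length ws + 2\<close> differences. Each is
  nonnegative on the left, nonpositive on the right, or nonzero, and the three bounds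
  \<open>1 + t\<close>, \<open>1 + t\<close> and \<open>2 + 2 * t\<close> add up to
  \<open>4 + 4 * t\<close>.\<close>

lemma counts_bounded_single:
  assumes "counts_bounded t (f, us, [v], ws)" "0 \<le> sum f V"
  shows "int (length us + length ws) \<le> 2 + 4 * t"
proof -
  let ?xs = "(lsum f # us) @ [v]" and ?ys = "ws @ [rsum f]"
  have xs: "count_diffs (\<lambda>d. d \<ge> 0) ?xs + count_diffs (\<lambda>d. \<not> d \<ge> 0) ?xs = int (length us) + 1"
    using count_diffs_compl[of ?xs "\<lambda>d. d \<ge> 0"] by simp
  have ys: "count_diffs (\<lambda>d. d \<le> 0) (v # ?ys) + count_diffs (\<lambda>d. \<not> d \<le> 0) (v # ?ys) = int (length ws) + 1"
    using count_diffs_compl[of "v # ?ys" "\<lambda>d. d \<le> 0"] by simp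
  have "count_diffs (\<lambda>d. d \<noteq> 0) (?xs @ ?ys) =
      count_diffs (\<lambda>d. d \<noteq> 0) ?xs + count_diffs (\<lambda>d. d \<noteq> 0) (v # ?ys)"
    using count_diffs_append[of ?xs ?ys "\<lambda>d. d \<noteq> 0"] count_diffs_Cons[of ?ys "\<lambda>d. d \<noteq> 0" v] by simp
  moreover have "count_diffs (\<lambda>d. \<not> d \<ge> 0) ?xs \<le> count_diffs (\<lambda>d. d \<noteq> 0) ?xs"
    by (rule count_diffs_mono) simp
  moreover have "count_diffs (\<lambda>d. \<not> d \<le> 0) (v # ?ys) \<le> count_diffs (\<lambda>d. d \<noteq> 0) (v # ?ys)"
    by (rule count_diffs_mono) simp
  ultimately show ?thesis using assms xs ys by simp
qed

end

section \<open>Stretched diagrams\<close>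

definition path_list :: "('v svert \<Rightarrow> int) \<Rightarrow> nat \<Rightarrow> int list" where
  "path_list b m = map (\<lambda>i. b (Path i)) [0..<Suc m]"

fun of_lists :: "('v \<Rightarrow> int) \<times> int list \<Rightarrow> 'v svert \<Rightarrow> int" where
  "of_lists (f, xs) (Off v) = f v"
| "of_lists (f, xs) (Path i) = (if i < length xs then xs ! i else 0)"

lemma length_path_list [simp]: "length (path_list b m) = Suc m"
  by (simp add: path_list_def)

lemma nth_path_list: "i \<le> m \<Longrightarrow> path_list b m ! i = b (Path i)"
  unfolding path_list_def by (subst nth_map) (auto simp del: upt_Suc)

lemma path_list_of_lists: "length xs = Suc n \<Longrightarrow> path_list (of_lists (f, xs)) n = xs"
  by (rule nth_equalityI) (auto simp: nth_path_list)

lemma of_lists_upd_Off: "(of_lists (f, xs))(Off v := c) = of_lists (f(v := c), xs)"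
proof
  fix z show "((of_lists (f, xs))(Off v := c)) z = of_lists (f(v := c), xs) z"
    by (cases z) auto
qed

lemma of_lists_upd_Path: "(of_lists (f, us @ v # vs))(Path (length us) := c) = of_lists (f, us @ c # vs)"
proof
  fix z show "((of_lists (f, us @ v # vs))(Path (length us) := c)) z = of_lists (f, us @ c # vs) z"
    by (cases z) (auto simp: nth_append nth_Cons')
qed

context
  fixes b :: "'v svert \<Rightarrow> int" and m us vs v
  assumes split: "path_list b m = us @ v # vs"
begin

lemma path_list_split_length: "m = length us + length vs"
  using arg_cong[OF split, of length] by simp

lemma path_list_split_nth: "b (Path (length us)) = v"
  using nth_path_list[of "length us" m b] path_list_split_length split by simp

text \<open>The default \<open>l\<close> stands for the value beyond the left end; it will be the
  weighted sum over \<open>L\<close>.\<close>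

lemma path_list_split_last:
  "last (l # us) = (if length us = 0 then l else b (Path (length us - 1)))"
  using nth_path_list[of "length us - 1" m b] path_list_split_length split
  by (auto simp: nth_append last_conv_nth)

lemma path_list_split_hd:
  "hd (vs @ [r]) = (if length us = m then r else b (Path (Suc (length us))))"
  using nth_path_list[of "Suc (length us)" m b] path_list_split_length split
  by (cases vs) (auto simp: nth_append)

lemma path_list_split_upd: "path_list (b(Path (length us) := c)) m = us @ c # vs"
proof (rule nth_equalityI)
  show "length (path_list (b(Path (length us) := c)) m) = length (us @ c # vs)"
    using path_list_split_length by simp
  fix i assume "i < length (path_list (b(Path (length us) := c)) m)"
  then show "path_list (b(Path (length us) := c)) m ! i = (us @ c # vs) ! i"
    using nth_path_list[of i m b] nth_path_list[of i m "b(Path (length us) := c)"] split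
    by (auto simp: nth_append nth_Cons')
qed

end

lemma path_list_upd_Off [simp]: "path_list (b(Off v := c)) m = path_list b m"
  by (simp add: path_list_def)

lemma path_list_insert:
  assumes "path_list b m = us @ vs"
  shows "path_list (insert_path (length us) c b) (Suc m) = us @ c # vs"
proof (rule nth_equalityI)
  have l: "Suc m = length us + length vs" using arg_cong[OF assms, of length] by simp
  then show "length (path_list (insert_path (length us) c b) (Suc m)) = length (us @ c # vs)" by simp
  fix i assume "i < length (path_list (insert_path (length us) c b) (Suc m))"
  then have i: "i \<le> Suc m"
    and *: "path_list (insert_path (length us) c b) (Suc m) ! i = insert_path (length us) c b (Path i)"
    using nth_path_list[of i "Suc m" "insert_path (length us) c b"] by auto
  consider "i < length us" | "i = length us" | j where "i = Suc j" "length us \<le> j"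
    by (metis linorder_neqE_nat less_eq_Suc_le Suc_le_D Suc_le_mono)
  then show "path_list (insert_path (length us) c b) (Suc m) ! i = (us @ c # vs) ! i"
  proof cases
    case 3
    then show ?thesis using nth_path_list[of j m b] * i assms by (simp add: nth_append Suc_diff_le)
  qed (use * nth_path_list[of i m b] l assms in \<open>auto simp: nth_append\<close>)
qed

lemma path_list_parts:
  assumes "path_list b m = us @ M @ ws"
  shows "us = map (\<lambda>i. b (Path i)) [0..<length us]"
    and "M = map (\<lambda>i. b (Path i)) [length us..<length us + length M]"
    and "ws = map (\<lambda>i. b (Path i)) [length us + length M..<Suc m]"
proof -
  have l: "Suc m = length us + length M + length ws" using arg_cong[OF assms, of length] by simp
  have "[0..<Suc m] = [0..<length us] @ [length us..<length us + length M] @ [length us + length M..<Suc m]"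
    unfolding l by (metis add.assoc add_0 upt_add_eq_append zero_le le_add1)
  then have "us @ M @ ws = map (\<lambda>i. b (Path i)) [0..<length us] @
      map (\<lambda>i. b (Path i)) [length us..<length us + length M] @
      map (\<lambda>i. b (Path i)) [length us + length M..<Suc m]"
    using assms unfolding path_list_def by (metis map_append)
  then show "us = map (\<lambda>i. b (Path i)) [0..<length us]"
    and "M = map (\<lambda>i. b (Path i)) [length us..<length us + length M]"
    and "ws = map (\<lambda>i. b (Path i)) [length us + length M..<Suc m]"
    by (auto simp: append_eq_append_conv simp del: upt_Suc)
qed

locale stretching =
  fixes G :: "'v diagram" and A :: "'v \<Rightarrow> 'v \<Rightarrow> int" and x :: 'v and L R :: "'v set"
  assumes coxeter: "coxeter_diagram G"
    and crystallographic: "crystallographic_cartan G A"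
    and elastic: "elastic_data G x L R"
begin

abbreviation "stG \<equiv> st_diagram G x L R"
abbreviation "stA \<equiv> st_cartan A x L R"
abbreviation "offs \<equiv> verts G - {x}"

definition lsum :: "('v \<Rightarrow> int) \<Rightarrow> int" where
  "lsum f = (\<Sum>y\<in>L. - A x y * f y)"

definition rsum :: "('v \<Rightarrow> int) \<Rightarrow> int" where
  "rsum f = (\<Sum>y\<in>R. - A x y * f y)"

text \<open>\<open>h\<close> and \<open>l\<close> are the first and last path values. The sum over
  \<open>offs\<close> contains the diagonal term at \<open>v\<close>, so the whole is
  \<open>f v\<close> minus the full pairing.\<close>

definition off_value :: "('v \<Rightarrow> int) \<Rightarrow> 'v \<Rightarrow> int \<Rightarrow> int \<Rightarrow> int" where
  "off_value f v h l = f v - ((\<Sum>y\<in>offs. A v y * f y) +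
     (if v \<in> L then A v x * h else 0) + (if v \<in> R then A v x * l else 0))"

sublocale path_model offs lsum rsum off_value .

lemma x_vert: "x \<in> verts G" and finite_verts: "finite (verts G)"
  using elastic coxeter by (auto simp: elastic_data_def coxeter_diagram_def)

lemma LR: "L \<subseteq> offs" "R \<subseteq> offs" "L \<inter> R = {}"
  using elastic by (auto simp: elastic_data_def neighbors_def)

sublocale cartan G A
  using coxeter crystallographic
  by unfold_locales (auto simp: coxeter_diagram_def crystallographic_cartan_def)

text \<open>Order 2 gives \<open>cos (pi / 2) = 0\<close>, so the product of the two entries
  vanishes, and the zero pattern is symmetric.\<close>

lemma unlabeled_zero:
  assumes "i \<in> verts G" "j \<in> verts G" "i \<noteq> j" "label G i j = 2"
  shows "A i j = 0"
proof -
  have "label G i j = enat 2" using assms(4) by (simp add: numeral_eq_enat)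
  then have "real_of_int (A i j * A j i) = 4 * (cos (pi / real 2))\<^sup>2"
    using crystallographic assms(1-3) unfolding crystallographic_cartan_def by fastforce
  then have "A i j * A j i = 0" by (simp del: of_int_mult)
  then show ?thesis using zero_sym assms by fastforce
qed

lemma verts_st: "verts (stG m) = Off ` offs \<union> Path ` {0..m}"
  by (simp add: st_diagram_def)

section \<open>Pairings and reflections in the stretched diagram\<close>

lemma st_cartan: "cartan (stG m) (stA m)"
proof
  show "finite (verts (stG m))" using finite_verts by (simp add: verts_st)
next
  fix i assume "i \<in> verts (stG m)"
  then show "stA m i i = 2" by (auto simp: verts_st diag)
next
  fix i j assume ij: "i \<in> verts (stG m)" "j \<in> verts (stG m)" "i \<noteq> j"
  show "stA m i j \<le> 0"
    using ij LR x_vert by (cases i; cases j) (auto simp: verts_st intro: offdiag)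
  assume "stA m i j = 0"
  then show "stA m j i = 0"
    using ij LR x_vert by (cases i; cases j) (auto simp: verts_st dest: zero_sym split: if_splits)
qed

text \<open>Vertices not adjacent to \<open>z\<close> have matrix entry 0, so the sum may run over
  all vertices other than \<open>z\<close>; the diagonal entry 2 turns \<open>- b z\<close> into
  \<open>b z\<close>.\<close>

lemma reflected_value_eq:
  assumes "z \<in> verts (stG m)"
  shows "reflected_value G A x L R m b z = b z - cartan.pairing (stG m) (stA m) z b"
proof -
  interpret S: cartan "stG m" "stA m" by (rule st_cartan)
  have "(\<Sum>y\<in>neighbors (stG m) z. - stA m z y * b y) = (\<Sum>y\<in>verts (stG m) - {z}. - stA m z y * b y)"
  proof (rule sum.mono_neutral_left)
    show "\<forall>y\<in>verts (stG m) - {z} - neighbors (stG m) z. - stA m z y * b y = 0"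
    proof
      fix y assume y: "y \<in> verts (stG m) - {z} - neighbors (stG m) z"
      then have "st_label (label G) x L R m z y = 2" by (auto simp: neighbors_def st_diagram_def)
      then show "- stA m z y * b y = 0"
        using y assms LR x_vert unlabeled_zero
        by (cases z; cases y) (auto simp: verts_st split: if_splits)
    qed
  qed (use S.finite_verts in \<open>auto simp: neighbors_def\<close>)
  also have "\<dots> = 2 * b z - S.pairing z b"
    using S.finite_verts assms
    by (simp add: S.pairing_def sum.remove[of _ z] S.diag sum_negf)
  finally show ?thesis by (simp add: reflected_value_def)
qed

lemma sum_verts_st:
  "(\<Sum>y\<in>verts (stG m). g y) = (\<Sum>y\<in>offs. g (Off y)) + (\<Sum>j\<le>m. g (Path j))"
proof -
  have "(\<Sum>y\<in>verts (stG m). g y) = sum g (Off ` offs) + sum g (Path ` {0..m})"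
    unfolding verts_st using finite_verts by (intro sum.union_disjoint) auto
  also have "sum g (Off ` offs) = (\<Sum>y\<in>offs. g (Off y))"
    by (subst sum.reindex) (auto simp: inj_on_def)
  also have "sum g (Path ` {0..m}) = (\<Sum>j\<le>m. g (Path j))"
    by (subst sum.reindex) (auto simp: inj_on_def atMost_atLeast0)
  finally show ?thesis .
qed

text \<open>The sums over \<open>L\<close> and \<open>R\<close> act as values at fictitious vertices
  beyond the two ends; for \<open>m = 0\<close> both meet at the same vertex.\<close>

lemma pairing_Path:
  assumes "i \<le> m"
  shows "cartan.pairing (stG m) (stA m) (Path i) b = 2 * b (Path i)
    - (if i = 0 then lsum (\<lambda>v. b (Off v)) else b (Path (i - 1)))
    - (if i = m then rsum (\<lambda>v. b (Off v)) else b (Path (Suc i)))"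
proof -
  interpret S: cartan "stG m" "stA m" by (rule st_cartan)
  have fin: "finite L" "finite R" using LR finite_verts by (meson finite_Diff finite_subset)+
  have "(\<Sum>y\<in>offs. stA m (Path i) (Off y) * b (Off y)) =
      (\<Sum>y\<in>offs. (if y \<in> L then (if i = 0 then A x y * b (Off y) else 0) else 0)
        + (if y \<in> R then (if i = m then A x y * b (Off y) else 0) else 0))"
    using LR by (intro sum.cong) auto
  also have "\<dots> = (\<Sum>y\<in>offs \<inter> L. if i = 0 then A x y * b (Off y) else 0)
      + (\<Sum>y\<in>offs \<inter> R. if i = m then A x y * b (Off y) else 0)"
    using finite_verts by (simp add: sum.distrib sum.inter_restrict)
  also have "\<dots> = (if i = 0 then - lsum (\<lambda>v. b (Off v)) else 0)
      + (if i = m then - rsum (\<lambda>v. b (Off v)) else 0)"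
    using LR by (simp add: lsum_def rsum_def sum_negf Int_absorb1)
  finally have 1: "(\<Sum>y\<in>offs. stA m (Path i) (Off y) * b (Off y)) =
      (if i = 0 then - lsum (\<lambda>v. b (Off v)) else 0) + (if i = m then - rsum (\<lambda>v. b (Off v)) else 0)" .
  \<comment> \<open>For \<open>i = 0\<close> the natural number \<open>i - 1\<close> is again 0,
    hence the inner test in the last summand.\<close>
  have "(\<Sum>j\<le>m. stA m (Path i) (Path j) * b (Path j)) =
      (\<Sum>j\<le>m. (if j = i then 2 * b (Path i) else 0) + (if j = Suc i then - b (Path (Suc i)) else 0)
        + (if j = i - 1 then (if i = 0 then 0 else - b (Path (i - 1))) else 0))"
    by (intro sum.cong) auto
  also have "\<dots> = 2 * b (Path i) + (if i = m then 0 else - b (Path (Suc i)))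
      + (if i = 0 then 0 else - b (Path (i - 1)))"
    using assms by (auto simp: sum.distrib)
  finally show ?thesis using 1 by (simp add: S.pairing_def sum_verts_st)
qed

lemma pairing_Off:
  assumes "v \<in> offs"
  shows "b (Off v) - cartan.pairing (stG m) (stA m) (Off v) b =
    off_value (\<lambda>v. b (Off v)) v (b (Path 0)) (b (Path m))"
proof -
  interpret S: cartan "stG m" "stA m" by (rule st_cartan)
  have "(\<Sum>j\<le>m. stA m (Off v) (Path j) * b (Path j)) =
      (\<Sum>j\<le>m. (if j = 0 then (if v \<in> L then A v x * b (Path 0) else 0) else 0)
        + (if j = m then (if v \<in> R then A v x * b (Path m) else 0) else 0))"
    using LR by (intro sum.cong) auto
  also have "\<dots> = (if v \<in> L then A v x * b (Path 0) else 0) + (if v \<in> R then A v x * b (Path m) else 0)"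
    by (simp add: sum.distrib)
  finally show ?thesis by (simp add: S.pairing_def sum_verts_st off_value_def)
qed

lemma reflected_value_Path:
  assumes "path_list b m = us @ v # vs"
  shows "reflected_value G A x L R m b (Path (length us)) =
    last (lsum (\<lambda>v. b (Off v)) # us) + hd (vs @ [rsum (\<lambda>v. b (Off v))]) - v"
proof -
  have "length us \<le> m" using path_list_split_length[OF assms] by simp
  then show ?thesis
    unfolding path_list_split_last[OF assms] path_list_split_hd[OF assms]
    using path_list_split_nth[OF assms]
    by (simp add: reflected_value_eq pairing_Path verts_st)
qed

lemma reflected_value_Off:
  assumes "v \<in> offs"
  shows "reflected_value G A x L R m b (Off v) =
    off_value (\<lambda>v. b (Off v)) v (hd (path_list b m)) (last (path_list b m))"
proof -
  have "hd (path_list b m) = b (Path 0)" "last (path_list b m) = b (Path m)"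
    using nth_path_list[of 0 m b] nth_path_list[of m m b] length_path_list[of b m]
    by (simp_all add: hd_conv_nth last_conv_nth flip: length_greater_0_conv)
  then show ?thesis using assms by (simp add: reflected_value_eq pairing_Off verts_st)
qed

lemma simple_refl_Path:
  assumes "length (us @ v # vs) = Suc n"
  shows "simple_refl (stG n) (stA n) (Path (length us)) (of_lists (f, us @ v # vs)) =
    of_lists (f, us @ (last (lsum f # us) + hd (vs @ [rsum f]) - v) # vs)"
proof -
  interpret S: cartan "stG n" "stA n" by (rule st_cartan)
  have *: "path_list (of_lists (f, us @ v # vs)) n = us @ v # vs"
    using assms by (rule path_list_of_lists)
  have "Path (length us) \<in> verts (stG n)" using assms by (auto simp: verts_st)
  then have "simple_refl (stG n) (stA n) (Path (length us)) (of_lists (f, us @ v # vs)) =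
      (of_lists (f, us @ v # vs))(Path (length us) :=
        reflected_value G A x L R n (of_lists (f, us @ v # vs)) (Path (length us)))"
    by (simp add: S.simple_refl_eq reflected_value_eq)
  then show ?thesis unfolding reflected_value_Path[OF *] of_lists_upd_Path by simp
qed

lemma simple_refl_Off:
  assumes "length xs = Suc n" "v \<in> offs"
  shows "simple_refl (stG n) (stA n) (Off v) (of_lists (f, xs)) =
    of_lists (f(v := off_value f v (hd xs) (last xs)), xs)"
proof -
  interpret S: cartan "stG n" "stA n" by (rule st_cartan)
  have "Off v \<in> verts (stG n)" using assms by (auto simp: verts_st)
  then show ?thesis
    using reflected_value_Off[OF assms(2), of n "of_lists (f, xs)"] of_lists_upd_Off[of f xs v]
      path_list_of_lists[OF assms(1), of f]
    by (simp add: S.simple_refl_eq reflected_value_eq)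
qed

section \<open>Descents of stretched functions as steps on lists\<close>

lemma list_step_length: "list_step s s' \<Longrightarrow> length (snd s') = length (snd s)"
  by (cases rule: list_step.cases) auto

lemma descent_iff_list_step:
  assumes "length (snd s) = Suc n"
  shows "cartan.descent (stG n) (stA n) (of_lists s) g \<longleftrightarrow> (\<exists>s'. list_step s s' \<and> g = of_lists s')"
proof -
  interpret S: cartan "stG n" "stA n" by (rule st_cartan)
  obtain f xs where s: "s = (f, xs)" by force
  show ?thesis
  proof
    assume "S.descent (of_lists s) g"
    then obtain z where z: "z \<in> verts (stG n)" "g = simple_refl (stG n) (stA n) z (of_lists s)"
        "g z < of_lists s z" "0 \<le> g z"
      using S.descent_def by blast
    show "\<exists>s'. list_step s s' \<and> g = of_lists s'"
    proof (cases z)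
      case (Off v)
      then have v: "v \<in> offs" using z(1) by (auto simp: verts_st)
      then have g: "g = of_lists (f(v := off_value f v (hd xs) (last xs)), xs)"
        using z(2) Off s simple_refl_Off[of xs n v f] assms by simp
      have "list_step s (f(v := off_value f v (hd xs) (last xs)), xs)"
        unfolding s using z(3,4) v Off s by (intro list_step.off) (simp_all add: g)
      then show ?thesis using g by blast
    next
      case (Path i)
      then have i: "i < length xs" using z(1) assms s by (auto simp: verts_st)
      define us v vs where "us = take i xs" and "v = xs ! i" and "vs = drop (Suc i) xs"
      have xs: "xs = us @ v # vs" "length us = i"
        using i by (auto simp: us_def v_def vs_def id_take_nth_drop)
      define c where "c = last (lsum f # us) + hd (vs @ [rsum f]) - v"
      have g: "g = of_lists (f, us @ c # vs)"
        using z(2) Path s simple_refl_Path[of us v vs n f] assms xs by (simp add: c_def)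
      have "g z = c" unfolding Path g xs(2)[symmetric] by simp
      moreover have "of_lists s z = v" unfolding Path s xs(1) xs(2)[symmetric] by simp
      ultimately have "0 \<le> c" "c < v" using z(3,4) by auto
      then have "list_step s (f, us @ c # vs)"
        unfolding s xs(1) by (intro list_step.path) (simp_all add: c_def)
      then show ?thesis using g by blast
    qed
  next
    assume "\<exists>s'. list_step s s' \<and> g = of_lists s'"
    then obtain s' where s': "list_step s s'" "g = of_lists s'" by blast
    from s'(1) show "S.descent (of_lists s) g"
    proof (cases rule: list_step.cases)
      case (off v c f xs)
      then show ?thesis unfolding S.descent_def
        using s' assms simple_refl_Off[of xs n v f] by (intro bexI[of _ "Off v"]) (auto simp: verts_st)
    next
      case (path c f us vs v)
      then show ?thesis unfolding S.descent_def
        using s' assms simple_refl_Path[of us v vs n f]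
        by (intro bexI[of _ "Path (length us)"]) (auto simp: verts_st)
    qed
  qed
qed

lemma descents_iff_list_steps:
  assumes "length (snd s) = Suc n"
  shows "(cartan.descent (stG n) (stA n))\<^sup>*\<^sup>* (of_lists s) g \<longleftrightarrow> (\<exists>s'. list_step\<^sup>*\<^sup>* s s' \<and> g = of_lists s')"
proof
  have len: "length (snd s') = Suc n" if "list_step\<^sup>*\<^sup>* s s'" for s'
    using that by (induction) (auto simp: assms dest: list_step_length)
  show "\<exists>s'. list_step\<^sup>*\<^sup>* s s' \<and> g = of_lists s'" if "(cartan.descent (stG n) (stA n))\<^sup>*\<^sup>* (of_lists s) g"
    using that
  proof (induction)
    case (step g g')
    then obtain s' where "list_step\<^sup>*\<^sup>* s s'" "g = of_lists s'" by blast
    then show ?case using step(2) descent_iff_list_step[of s' n g'] len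
      by (meson rtranclp.rtrancl_into_rtrancl)
  qed blast
  assume "\<exists>s'. list_step\<^sup>*\<^sup>* s s' \<and> g = of_lists s'"
  then obtain s' where "list_step\<^sup>*\<^sup>* s s'" "g = of_lists s'" by blast
  from this(1) have "(cartan.descent (stG n) (stA n))\<^sup>*\<^sup>* (of_lists s) (of_lists s')"
  proof (induction)
    case (step s1 s2)
    have "cartan.descent (stG n) (stA n) (of_lists s1) (of_lists s2)"
      using descent_iff_list_step[OF len[OF step(1)]] step(2) by blast
    then show ?case using step by simp
  qed simp
  then show "(cartan.descent (stG n) (stA n))\<^sup>*\<^sup>* (of_lists s) g" using \<open>g = of_lists s'\<close> by simp
qed

subsection \<open>Stretched roots are roots\<close>

lemma root_reflect_Path:
  assumes "of_lists (f, us @ v # vs) \<in> root_system (stG n) (stA n)" "length (us @ v # vs) = Suc n"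
    and "c = last (lsum f # us) + hd (vs @ [rsum f]) - v"
  shows "of_lists (f, us @ c # vs) \<in> root_system (stG n) (stA n)"
proof -
  interpret S: cartan "stG n" "stA n" by (rule st_cartan)
  have "Path (length us) \<in> verts (stG n)" using assms(2) by (auto simp: verts_st)
  then show ?thesis
    using S.simple_refl_root_system[OF assms(1)] simple_refl_Path[OF assms(2), of f] assms(3) by metis
qed

text \<open>The cancellation \<open>c + d - d = c\<close> of \<open>spread_right\<close>, with no
  inequality imposed: only membership in the root system is claimed, and values may rise.\<close>

lemma root_sweep_right:
  assumes "of_lists (f, us @ replicate k d @ vs) \<in> root_system (stG n) (stA n)"
    and "length us + k + length vs = Suc n" "last (lsum f # us) = c" "hd (vs @ [rsum f]) = d"
  shows "of_lists (f, us @ replicate k c @ vs) \<in> root_system (stG n) (stA n)"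
  using assms(1-3)
proof (induction k arbitrary: us)
  case (Suc k)
  have "of_lists (f, us @ c # replicate k d @ vs) \<in> root_system (stG n) (stA n)"
    by (rule root_reflect_Path[of f us d]) (use Suc.prems assms(4) in \<open>auto simp: hd_append\<close>)
  then show ?case using Suc.IH[of "us @ [c]"] Suc.prems by simp
qed simp

lemma root_sweep_left:
  assumes "of_lists (f, us @ replicate k c @ vs) \<in> root_system (stG n) (stA n)"
    and "length us + k + length vs = Suc n" "last (lsum f # us) = c" "hd (vs @ [rsum f]) = d"
  shows "of_lists (f, us @ replicate k d @ vs) \<in> root_system (stG n) (stA n)"
  using assms(1,2,4)
proof (induction k arbitrary: vs)
  case (Suc k)
  have "of_lists (f, (us @ replicate k c) @ d # vs) \<in> root_system (stG n) (stA n)"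
    by (rule root_reflect_Path[of f "us @ replicate k c" c])
      (use Suc.prems assms(3) in \<open>auto simp: last_append replicate_append_same replicate_app_Cons_same\<close>)
  then show ?case using Suc.IH[of "d # vs"] Suc.prems by (simp add: replicate_app_Cons_same)
qed simp

lemma st_fun_eq: "st_fun x n \<beta> = of_lists (\<lambda>v. if v = x then 0 else \<beta> v, replicate (Suc n) (\<beta> x))"
proof
  fix z show "st_fun x n \<beta> z = of_lists (\<lambda>v. if v = x then 0 else \<beta> v, replicate (Suc n) (\<beta> x)) z"
    by (cases z) (auto simp del: replicate_Suc)
qed

lemma pairing_lsum_rsum:
  "pairing x \<beta> = 2 * \<beta> x - lsum \<beta> - rsum \<beta>"
proof -
  have "(\<Sum>y\<in>verts G. A x y * \<beta> y) = A x x * \<beta> x + (\<Sum>y\<in>offs. A x y * \<beta> y)"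
    using finite_verts x_vert by (simp add: sum.remove)
  also have "(\<Sum>y\<in>offs. A x y * \<beta> y) = (\<Sum>y\<in>L \<union> R. A x y * \<beta> y)"
  proof (rule sum.mono_neutral_right)
    show "\<forall>y\<in>offs - (L \<union> R). A x y * \<beta> y = 0"
      using elastic unlabeled_zero x_vert by (auto simp: elastic_data_def neighbors_def)
  qed (use LR finite_verts in auto)
  also have "\<dots> = - lsum \<beta> - rsum \<beta>"
    using LR finite_verts by (subst sum.union_disjoint) (auto simp: lsum_def rsum_def sum_negf dest: finite_subset)
  finally show ?thesis using diag x_vert by (simp add: pairing_def)
qed

lemma pairing_off_value:
  assumes "v \<in> offs"
  shows "\<beta> v - pairing v \<beta> = off_value \<beta> v (\<beta> x) (\<beta> x)"
proof -
  have "(\<Sum>y\<in>verts G. A v y * \<beta> y) = A v x * \<beta> x + (\<Sum>y\<in>offs. A v y * \<beta> y)"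
    using finite_verts x_vert by (simp add: sum.remove)
  moreover have "A v x = 0" if "v \<notin> L \<union> R"
    using that elastic unlabeled_zero[of x v] zero_sym[of x v] x_vert assms
    by (auto simp: elastic_data_def neighbors_def)
  moreover have "\<not> (v \<in> L \<and> v \<in> R)" using LR by auto
  ultimately show ?thesis by (auto simp: pairing_def off_value_def)
qed

text \<open>Serves to clear the value at \<open>x\<close>, as \<open>st_fun\<close> does off the
  path.\<close>

lemma off_cong:
  assumes "\<And>v. v \<in> offs \<Longrightarrow> f v = g v"
  shows "lsum f = lsum g" "rsum f = rsum g" "w \<in> offs \<Longrightarrow> off_value f w h l = off_value g w h l"
proof -
  have "\<forall>v\<in>L. f v = g v" "\<forall>v\<in>R. f v = g v" using assms LR by blast+
  then show "lsum f = lsum g" "rsum f = rsum g" by (simp_all add: lsum_def rsum_def)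
  show "w \<in> offs \<Longrightarrow> off_value f w h l = off_value g w h l" using assms by (simp add: off_value_def)
qed

text \<open>Each reflection in an expression of \<open>\<beta>\<close> is lifted to the stretched
  diagram: to one reflection at a vertex off the path, and to a sweep along the path and back for
  \<open>x\<close>.\<close>

lemma st_fun_root:
  assumes "\<beta> \<in> root_system G A"
  shows "st_fun x n \<beta> \<in> root_system (stG n) (stA n)"
proof -
  interpret S: cartan "stG n" "stA n" by (rule st_cartan)
  obtain w y where wy: "set w \<subseteq> verts G" "y \<in> verts G" "\<beta> = act w (simple_root y)"
    using assms by (auto simp: root_system_def is_expression_def)
  have simple: "simple_root z \<in> root_system (stG n) (stA n)" if "z \<in> verts (stG n)" for z
    unfolding root_system_def is_expression_def using that by (intro CollectI exI[of _ "[]"]) auto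
  have "st_fun x n (act w (simple_root y)) \<in> root_system (stG n) (stA n)"
    using wy(1)
  proof (induction w)
    case Nil
    show ?case
    proof (cases "y = x")
      case True
      have s: "simple_root (Path 0) = of_lists (\<lambda>_. 0, [1] @ replicate n 0 @ [])"
      proof
        fix z show "simple_root (Path 0) z = of_lists (\<lambda>_. 0, [1] @ replicate n 0 @ []) z"
          by (cases z) (auto simp: simple_root_def nth_Cons')
      qed
      \<comment> \<open>Starting from the simple root at the left end, the value 1 sweeps over the
        zeros of the path.\<close>
      have "of_lists (\<lambda>_. 0, [1] @ replicate n 1 @ []) \<in> root_system (stG n) (stA n)"
      proof (rule root_sweep_right)
        show "of_lists (\<lambda>_. 0, [1] @ replicate n 0 @ []) \<in> root_system (stG n) (stA n)"
          using simple[of "Path 0"] unfolding s by (simp add: verts_st)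
      qed (auto simp: rsum_def)
      moreover have "(\<lambda>v. if v = x then 0 else simple_root x v) = (\<lambda>_. 0)" by (auto simp: simple_root_def)
      ultimately show ?thesis using True by (simp add: st_fun_eq simple_root_def cong: if_cong)
    next
      case False
      have "st_fun x n (simple_root y) = simple_root (Off y)"
      proof
        fix z show "st_fun x n (simple_root y) z = simple_root (Off y) z"
          using False by (cases z) (auto simp: simple_root_def)
      qed
      then show ?thesis using simple[of "Off y"] False wy(2) by (simp add: verts_st)
    qed
  next
    case (Cons i w)
    define \<gamma> where "\<gamma> = act w (simple_root y)"
    define f where "f = (\<lambda>v. if v = x then 0 else \<gamma> v)"
    have i: "i \<in> verts G" using Cons.prems by simp
    have root: "of_lists (f, replicate (Suc n) (\<gamma> x)) \<in> root_system (stG n) (stA n)"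
      using Cons unfolding st_fun_eq f_def \<gamma>_def by simp
    have refl: "simple_refl G A i \<gamma> = \<gamma>(i := \<gamma> i - pairing i \<gamma>)" using i by (rule simple_refl_eq)
    have cong: "lsum f = lsum \<gamma>" "rsum f = rsum \<gamma>" "\<And>w h l. w \<in> offs \<Longrightarrow> off_value f w h l = off_value \<gamma> w h l"
      by (intro off_cong; simp add: f_def)+
    show ?case
    proof (cases "i = x")
      case True
      define c where "c = lsum f + rsum f - \<gamma> x"
      have c: "c = \<gamma> x - pairing x \<gamma>" by (simp add: c_def cong pairing_lsum_rsum)
      \<comment> \<open>Sweeping right puts the left sum on all path vertices but the last.
        Reflecting there yields \<open>c\<close>, the reflected value at \<open>x\<close>, and
        sweeping back spreads \<open>c\<close> over the path.\<close>
      have "of_lists (f, [] @ replicate n (\<gamma> x) @ [\<gamma> x]) \<in> root_system (stG n) (stA n)"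
        using root by (simp add: replicate_append_same)
      then have "of_lists (f, [] @ replicate n (lsum f) @ [\<gamma> x]) \<in> root_system (stG n) (stA n)"
        by (rule root_sweep_right) auto
      then have "of_lists (f, replicate n (lsum f) @ \<gamma> x # []) \<in> root_system (stG n) (stA n)" by simp
      then have "of_lists (f, replicate n (lsum f) @ c # []) \<in> root_system (stG n) (stA n)"
        by (rule root_reflect_Path) (auto simp: c_def)
      then have "of_lists (f, [] @ replicate n (lsum f) @ [c]) \<in> root_system (stG n) (stA n)" by simp
      then have "of_lists (f, [] @ replicate n c @ [c]) \<in> root_system (stG n) (stA n)"
        by (rule root_sweep_left) auto
      then have "of_lists (f, replicate (Suc n) c) \<in> root_system (stG n) (stA n)"
        by (simp add: replicate_append_same)
      moreover have "f = (\<lambda>v. if v = x then 0 else simple_refl G A i \<gamma> v)" "simple_refl G A i \<gamma> x = c"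
        using True c refl by (auto simp: f_def)
      ultimately show ?thesis by (simp add: st_fun_eq flip: \<gamma>_def)
    next
      case False
      then have "i \<in> offs" using i by simp
      then have "Off i \<in> verts (stG n)" by (simp add: verts_st)
      then have "of_lists (f(i := off_value f i (\<gamma> x) (\<gamma> x)), replicate (Suc n) (\<gamma> x)) \<in> root_system (stG n) (stA n)"
        using S.simple_refl_root_system[OF root, of "Off i"] \<open>i \<in> offs\<close>
          simple_refl_Off[of "replicate (Suc n) (\<gamma> x)" n i f]
        by (simp del: replicate_Suc)
      moreover have "f(i := off_value f i (\<gamma> x) (\<gamma> x)) = (\<lambda>v. if v = x then 0 else simple_refl G A i \<gamma> v)"
        "simple_refl G A i \<gamma> x = \<gamma> x"
        using False refl cong(3)[OF \<open>i \<in> offs\<close>] pairing_off_value[OF \<open>i \<in> offs\<close>, of \<gamma>] by (auto simp: f_def)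
      ultimately show ?thesis by (simp add: st_fun_eq flip: \<gamma>_def)
    qed
  qed
  then show ?thesis using wy(3) by simp
qed

subsection \<open>Operations on classes\<close>

text \<open>The condition \<open>M \<noteq> []\<close> expresses \<open>p \<le> q\<close>, which the
  type of marked functions leaves open.\<close>

fun represents :: "'v marked \<Rightarrow> ('v \<Rightarrow> int) \<times> int list \<times> int list \<times> int list \<Rightarrow> bool" where
  "represents (m, b, p, q) (f, us, M, ws) \<longleftrightarrow> f = (\<lambda>v. b (Off v)) \<and> path_list b m = us @ M @ ws \<and>
     length us = p \<and> p + length M = Suc q \<and> M \<noteq> []"

lemma represents_nonempty: "represents c C \<Longrightarrow> fst (snd (snd C)) \<noteq> []"
  by (cases c; cases C) auto

lemma nonneg_marked_iff:
  assumes "represents c (f, us, M, ws)"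
  shows "nonneg_marked G x L R c \<longleftrightarrow> (\<forall>v\<in>offs. 0 \<le> f v) \<and> (\<forall>a\<in>set (us @ M @ ws). 0 \<le> a)"
proof -
  obtain m b p q where c: "c = (m, b, p, q)" by (cases c)
  have "set (path_list b m) = (\<lambda>i. b (Path i)) ` {0..m}"
    by (simp add: path_list_def atLeastLessThanSuc_atLeastAtMost del: upt_Suc)
  then show ?thesis using assms unfolding c by (auto simp: verts_st)
qed

lemma stretching_class_eq:
  assumes "represents c C"
  shows "stretching_class c n = of_lists ` {s \<in> elems C. length (snd s) = Suc n}"
proof -
  obtain m b p q where c: "c = (m, b, p, q)" by (cases c)
  obtain f us M ws where C: "C = (f, us, M, ws)" by (cases C)
  have rep: "f = (\<lambda>v. b (Off v))" "path_list b m = us @ M @ ws" "length us = p" "p + length M = Suc q"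
    using assms c C by auto
  note parts = path_list_parts[OF rep(2), unfolded rep(3,4)]
  have M: "stretched M ys \<longleftrightarrow> (\<exists>k. (\<forall>j\<in>{p..q}. 0 < k j) \<and>
      ys = concat (map (\<lambda>j. replicate (k j) (b (Path j))) [p..<Suc q]))" for ys
    using stretched_concat_iff[of "[p..<Suc q]" "\<lambda>i. b (Path i)" ys] parts(2)
    by (simp add: atLeastLessThanSuc_atLeastAtMost del: upt_Suc)
  have cl: "g \<in> stretching_class c n \<longleftrightarrow> (\<forall>v. g (Off v) = b (Off v)) \<and> (\<forall>i>n. g (Path i) = 0) \<and>
      (\<exists>ys. stretched M ys \<and> path_list g n = us @ ys @ ws)" for g
    unfolding M c using parts(1,3) by (auto simp: path_list_def simp del: upt_Suc)
  show ?thesis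
  proof (intro set_eqI iffI)
    fix g assume "g \<in> stretching_class c n"
    then obtain ys where ys: "\<forall>v. g (Off v) = b (Off v)" "\<forall>i>n. g (Path i) = 0"
        "stretched M ys" "path_list g n = us @ ys @ ws"
      using cl by blast
    have "g = of_lists (f, path_list g n)"
    proof
      fix z show "g z = of_lists (f, path_list g n) z"
        using ys(1,2) rep(1) by (cases z) (auto simp: nth_path_list)
    qed
    moreover have "(f, path_list g n) \<in> elems C" using ys C by auto
    ultimately show "g \<in> of_lists ` {s \<in> elems C. length (snd s) = Suc n}"
      by (intro image_eqI[of _ _ "(f, path_list g n)"]) auto
  next
    fix g assume "g \<in> of_lists ` {s \<in> elems C. length (snd s) = Suc n}"
    then obtain ys where ys: "stretched M ys" "length (us @ ys @ ws) = Suc n" "g = of_lists (f, us @ ys @ ws)"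
      using C by auto
    then show "g \<in> stretching_class c n"
      using cl path_list_of_lists[OF ys(2), of f] rep(1) by auto
  qed
qed

lemma left_sum_eq:
  assumes "path_list b m = us @ v # vs"
  shows "left_sum A x L R m b (length us) = last (lsum (\<lambda>v. b (Off v)) # us)"
proof -
  have "(\<Sum>y\<in>Off ` L. - stA m (Path 0) y * b y) = lsum (\<lambda>v. b (Off v))"
    by (subst sum.reindex) (auto simp: inj_on_def lsum_def)
  then show ?thesis unfolding path_list_split_last[OF assms] left_sum_def class_left_def
    by (cases us) auto
qed

lemma right_sum_eq:
  assumes "path_list b m = us @ v # vs"
  shows "right_sum A x L R m b (length us) = hd (vs @ [rsum (\<lambda>v. b (Off v))])"
proof -
  have "(\<Sum>y\<in>Off ` R. - stA m (Path m) y * b y) = rsum (\<lambda>v. b (Off v))"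
    by (subst sum.reindex) (auto simp: inj_on_def rsum_def)
  then show ?thesis unfolding path_list_split_hd[OF assms] right_sum_def class_right_def by auto
qed

lemma list_split_at: "i < length xs \<Longrightarrow> \<exists>us v vs. xs = us @ v # vs \<and> length us = i"
  by (intro exI[of _ "take i xs"] exI[of _ "xs ! i"] exI[of _ "drop (Suc i) xs"])
    (auto simp: id_take_nth_drop)

text \<open>Carries the list invariants along the arrows of the class graph.\<close>

lemma class_op_imp_list_op:
  assumes "class_op G A x L R c c'" "represents c C"
  shows "\<exists>C'. represents c' C' \<and> list_op C C'"
proof -
  obtain f us M ws where C: "C = (f, us, M, ws)" by (cases C)
  show ?thesis
    using assms(1)
  proof (cases rule: class_op.cases)
    case (unmarked z m p q c0 b)
    have rep: "f = (\<lambda>v. b (Off v))" "path_list b m = us @ M @ ws" "length us = p" "p + length M = Suc q" "M \<noteq> []"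
      using assms(2) unmarked(1) C by auto
    have len: "Suc m = length us + length M + length ws" using arg_cong[OF rep(2), of length] by simp
    show ?thesis
    proof (cases z)
      case (Off v)
      then have v: "v \<in> offs" using unmarked(3) by (auto simp: verts_st)
      have "c0 = off_value f v (hd (us @ M)) (last (M @ ws))"
        using unmarked(5) reflected_value_Off[OF v, of m b] rep Off
        by (cases us; cases ws rule: rev_cases) (auto simp: hd_append)
      then have "list_op C (f(v := c0), us, M, ws)"
        unfolding C using v unmarked(6) Off rep(1) by (intro list_op.off) auto
      moreover have "represents c' (f(v := c0), us, M, ws)"
        unfolding unmarked(2) using rep Off by auto
      ultimately show ?thesis by blast
    next
      case (Path i)
      then have i: "i \<le> m" "i < p \<or> q < i" using unmarked(3,4) by (auto simp: verts_st)
      from i(2) show ?thesis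
      proof
        assume "i < p"
        then obtain us1 v us2 where us: "us = us1 @ v # us2" "length us1 = i"
          using list_split_at rep(3) by blast
        have split: "path_list b m = us1 @ v # (us2 @ M @ ws)" using rep(2) us by simp
        have "c0 = last (lsum f # us1) + hd (us2 @ M) - v"
          using unmarked(5) reflected_value_Path[OF split] us Path rep(1,5) by (auto simp: hd_append)
        then have "list_op C (f, us1 @ c0 # us2, M, ws)"
          unfolding C us using unmarked(6) path_list_split_nth[OF split] us Path by (intro list_op.pre) auto
        moreover have "represents c' (f, us1 @ c0 # us2, M, ws)"
          unfolding unmarked(2) Path using rep us path_list_split_upd[OF split, of c0] by auto
        ultimately show ?thesis by blast
      next
        assume "q < i"
        then have "i - Suc q < length ws" using len rep(3,4) i(1) by linarith
        then obtain ws1 v ws2 where ws: "ws = ws1 @ v # ws2" "length ws1 = i - Suc q"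
          using list_split_at by blast
        have split: "path_list b m = (us @ M @ ws1) @ v # ws2" using rep(2) ws by simp
        have li: "length (us @ M @ ws1) = i" using ws rep(3,4) \<open>q < i\<close> by simp
        have "last (lsum f # us @ M @ ws1) = last (M @ ws1)" using rep(5) by (simp add: last_append)
        then have "c0 = last (M @ ws1) + hd (ws2 @ [rsum f]) - v"
          using unmarked(5) reflected_value_Path[OF split] li Path rep(1) by simp
        then have "list_op C (f, us, M, ws1 @ c0 # ws2)"
          unfolding C ws using unmarked(6) path_list_split_nth[OF split] li Path by (intro list_op.suf) auto
        moreover have "represents c' (f, us, M, ws1 @ c0 # ws2)"
          unfolding unmarked(2) Path using rep path_list_split_upd[OF split, of c0] li by auto
        ultimately show ?thesis by blast
      qed
    qed
  next
    case (internal p j q c0 m b)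
    have rep: "f = (\<lambda>v. b (Off v))" "path_list b m = us @ M @ ws" "length us = p" "p + length M = Suc q" "M \<noteq> []"
      using assms(2) internal(1) C by auto
    have "j - p < length M" using internal(3,4) rep by simp
    then obtain N1 v N2 where N: "M = N1 @ v # N2" "length N1 = j - p" using list_split_at by blast
    then have "N1 \<noteq> []" "N2 \<noteq> []" using internal(3,4) rep by auto
    then obtain M1 a d M2 where M12: "N1 = M1 @ [a]" "N2 = d # M2"
      by (metis rev_exhaust list.exhaust)
    have split: "path_list b m = (us @ M1 @ [a]) @ v # (d # M2 @ ws)" using rep(2) N M12 by simp
    have lj: "length (us @ M1 @ [a]) = j" using N M12 rep internal(3) by simp
    have "c0 = a + d - v" using internal(5) reflected_value_Path[OF split] lj by simp
    then have "list_op C (f, us, M1 @ a # c0 # d # M2, ws)"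
      unfolding C N M12 using internal(6) path_list_split_nth[OF split] lj list_op.int[of c0 a d v f us M1 M2 ws]
      by simp
    moreover have "represents c' (f, us, M1 @ a # c0 # d # M2, ws)"
      unfolding internal(2) using rep N M12 path_list_split_upd[OF split, of c0] lj by auto
    ultimately show ?thesis by blast
  next
    case (insert_left c0 m b p q)
    have rep: "f = (\<lambda>v. b (Off v))" "path_list b m = us @ M @ ws" "length us = p" "p + length M = Suc q" "M \<noteq> []"
      using assms(2) insert_left(1) C by auto
    obtain v N where M: "M = v # N" using rep(5) by (cases M) auto
    have split: "path_list b m = us @ v # (N @ ws)" using rep(2) M by simp
    have "list_op C (f, us, c0 # v # N, ws)"
      unfolding C M using insert_left(3,4) left_sum_eq[OF split] path_list_split_nth[OF split] rep
      by (intro list_op.insl) auto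
    moreover have "represents c' (f, us, c0 # v # N, ws)"
      unfolding insert_left(2) using rep M path_list_insert[of b m us "v # N @ ws" c0] split by auto
    ultimately show ?thesis by blast
  next
    case (insert_right c0 m b q p)
    have rep: "f = (\<lambda>v. b (Off v))" "path_list b m = us @ M @ ws" "length us = p" "p + length M = Suc q" "M \<noteq> []"
      using assms(2) insert_right(1) C by auto
    obtain v N where M: "M = N @ [v]" using rep(5) by (cases M rule: rev_cases) auto
    have split: "path_list b m = (us @ N) @ v # ws" using rep(2) M by simp
    have lq: "length (us @ N) = q" using rep M by simp
    have "list_op C (f, us, N @ [v, c0], ws)"
      unfolding C M using insert_right(3,4) right_sum_eq[OF split] path_list_split_nth[OF split] rep lq
      by (intro list_op.insr) auto
    moreover have "represents c' (f, us, N @ [v, c0], ws)"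
      unfolding insert_right(2) using rep M path_list_insert[of b m "us @ M" ws c0] by auto
    ultimately show ?thesis by blast
  next
    case (left_endpoint p q c0 m b)
    have rep: "f = (\<lambda>v. b (Off v))" "path_list b m = us @ M @ ws" "length us = p" "p + length M = Suc q" "M \<noteq> []"
      using assms(2) left_endpoint(1) C by auto
    obtain v d N where M: "M = v # d # N" using rep left_endpoint(3)
      by (cases M; cases "tl M") auto
    have split: "path_list b m = us @ v # (d # N @ ws)" using rep(2) M by simp
    have split': "path_list b m = (us @ [v]) @ d # (N @ ws)" using rep(2) M by simp
    have d: "b (Path (p + 1)) = d" using path_list_split_nth[OF split'] rep by simp
    have c0: "c0 = last (lsum f # us) + d - v" "c0 < v"
      using left_endpoint(4,5) reflected_value_Path[OF split] path_list_split_nth[OF split] rep by auto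
    note upd = path_list_split_upd[OF split, of c0]
    show ?thesis
    proof (cases "c0 < d")
      case True
      then have "list_op C (f, us, c0 # d # N, ws)" unfolding C M using c0 by (intro list_op.lend)
      moreover have "represents c' (f, us, c0 # d # N, ws)"
        unfolding left_endpoint(2) using rep M upd d True by auto
      ultimately show ?thesis by blast
    next
      case False
      then have "list_op C (f, us @ [c0], d # N, ws)" unfolding C M using c0 by (intro list_op.lend') auto
      moreover have "represents c' (f, us @ [c0], d # N, ws)"
        unfolding left_endpoint(2) using rep M upd d False by auto
      ultimately show ?thesis by blast
    qed
  next
    case (right_endpoint p q c0 m b)
    have rep: "f = (\<lambda>v. b (Off v))" "path_list b m = us @ M @ ws" "length us = p" "p + length M = Suc q" "M \<noteq> []"
      using assms(2) right_endpoint(1) C by auto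
    obtain v a N where M: "M = N @ [a, v]" using rep right_endpoint(3)
      by (cases M rule: rev_cases; cases "butlast M" rule: rev_cases) auto
    have split: "path_list b m = (us @ N @ [a]) @ v # ws" using rep(2) M by simp
    have split': "path_list b m = (us @ N) @ a # (v # ws)" using rep(2) M by simp
    have lq: "length (us @ N @ [a]) = q" "length (us @ N) = q - 1" using rep M by auto
    have a: "b (Path (q - 1)) = a" using path_list_split_nth[OF split'] lq by simp
    have c0: "c0 = a + hd (ws @ [rsum f]) - v" "c0 < v"
      using right_endpoint(4,5) reflected_value_Path[OF split] path_list_split_nth[OF split] rep lq by auto
    note upd = path_list_split_upd[OF split, of c0, unfolded lq(1)]
    show ?thesis
    proof (cases "c0 < a")
      case True
      then have "list_op C (f, us, N @ [a, c0], ws)" unfolding C M using c0 by (intro list_op.rend)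
      moreover have "represents c' (f, us, N @ [a, c0], ws)"
        unfolding right_endpoint(2) using rep M upd a True by auto
      ultimately show ?thesis by blast
    next
      case False
      then have "list_op C (f, us, N @ [a], c0 # ws)" unfolding C M using c0 by (intro list_op.rend') auto
      moreover have "represents c' (f, us, N @ [a], c0 # ws)"
        unfolding right_endpoint(2) using rep M upd a False by auto
      ultimately show ?thesis by blast
    qed
  qed
qed

text \<open>Turns the list operation found for a descent into an arrow of the class graph.\<close>

lemma list_op_imp_class_op:
  assumes "list_op C C'" "represents c C"
  shows "\<exists>c'. class_op G A x L R c c' \<and> represents c' C'"
proof -
  obtain m b p q where c: "c = (m, b, p, q)" by (cases c)
  show ?thesis
    using assms(1)
  proof (cases rule: list_op.cases)
    case (off v c0 f us M ws)
    have rep: "f = (\<lambda>v. b (Off v))" "path_list b m = us @ M @ ws" "length us = p" "p + length M = Suc q" "M \<noteq> []"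
      using assms(2) c off(1) by auto
    have "c0 = reflected_value G A x L R m b (Off v)"
      using off(4) reflected_value_Off[OF off(3), of m b] rep
      by (cases us; cases ws rule: rev_cases) (auto simp: hd_append)
    then have "class_op G A x L R c (m, b(Off v := c0), p, q)"
      unfolding c using off rep by (intro class_op.unmarked) (auto simp: verts_st)
    moreover have "represents (m, b(Off v := c0), p, q) C'" unfolding off(2) using rep by auto
    ultimately show ?thesis by blast
  next
    case (pre c0 f us1 us2 M v ws)
    have rep: "f = (\<lambda>v. b (Off v))" "path_list b m = (us1 @ v # us2) @ M @ ws" "length (us1 @ v # us2) = p"
        "p + length M = Suc q" "M \<noteq> []"
      using assms(2) c pre(1) by auto
    have split: "path_list b m = us1 @ v # (us2 @ M @ ws)" using rep(2) by simp
    have "c0 = reflected_value G A x L R m b (Path (length us1))"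
      using pre(3) reflected_value_Path[OF split] rep(1,5) by (auto simp: hd_append)
    then have "class_op G A x L R c (m, b(Path (length us1) := c0), p, q)"
      unfolding c using pre(4) rep path_list_split_nth[OF split] path_list_split_length[OF split]
      by (intro class_op.unmarked) (auto simp: verts_st)
    moreover have "represents (m, b(Path (length us1) := c0), p, q) C'"
      unfolding pre(2) using rep path_list_split_upd[OF split, of c0] by auto
    ultimately show ?thesis by blast
  next
    case (suf c0 M ws1 ws2 f v us)
    have rep: "f = (\<lambda>v. b (Off v))" "path_list b m = us @ M @ (ws1 @ v # ws2)" "length us = p"
        "p + length M = Suc q" "M \<noteq> []"
      using assms(2) c suf(1) by auto
    have split: "path_list b m = (us @ M @ ws1) @ v # ws2" using rep(2) by simp
    have "last (lsum f # us @ M @ ws1) = last (M @ ws1)" using rep(5) by (simp add: last_append)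
    then have "c0 = reflected_value G A x L R m b (Path (length (us @ M @ ws1)))"
      using suf(3) reflected_value_Path[OF split] rep(1) by simp
    then have "class_op G A x L R c (m, b(Path (length (us @ M @ ws1)) := c0), p, q)"
      unfolding c using suf(4) rep path_list_split_nth[OF split] path_list_split_length[OF split]
      by (intro class_op.unmarked) (auto simp: verts_st)
    moreover have "represents (m, b(Path (length (us @ M @ ws1)) := c0), p, q) C'"
      unfolding suf(2) using rep path_list_split_upd[OF split, of c0] by auto
    ultimately show ?thesis by blast
  next
    case (int c0 a d v f us M1 M2 ws)
    have rep: "f = (\<lambda>v. b (Off v))" "path_list b m = us @ (M1 @ a # v # d # M2) @ ws" "length us = p"
        "p + length (M1 @ a # v # d # M2) = Suc q"
      using assms(2) c int(1) by auto
    have split: "path_list b m = (us @ M1 @ [a]) @ v # (d # M2 @ ws)" using rep(2) by simp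
    have "c0 = reflected_value G A x L R m b (Path (length (us @ M1 @ [a])))"
      using int(3) reflected_value_Path[OF split] by simp
    then have "class_op G A x L R c (m, b(Path (length (us @ M1 @ [a])) := c0), p, q)"
      unfolding c using int(4) rep path_list_split_nth[OF split] by (intro class_op.internal) auto
    moreover have "represents (m, b(Path (length (us @ M1 @ [a])) := c0), p, q) C'"
      unfolding int(2) using rep path_list_split_upd[OF split, of c0] by auto
    ultimately show ?thesis by blast
  next
    case (insl c0 f us v M ws)
    have rep: "f = (\<lambda>v. b (Off v))" "path_list b m = us @ (v # M) @ ws" "length us = p"
        "p + length (v # M) = Suc q"
      using assms(2) c insl(1) by auto
    have split: "path_list b m = us @ v # (M @ ws)" using rep(2) by simp
    have "class_op G A x L R c (Suc m, insert_path p c0 b, p, Suc q)"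
      unfolding c using insl(3,4) rep path_list_split_nth[OF split] left_sum_eq[OF split]
      by (intro class_op.insert_left) auto
    moreover have "represents (Suc m, insert_path p c0 b, p, Suc q) C'"
      unfolding insl(2) using rep path_list_insert[of b m us "v # M @ ws" c0] by auto
    ultimately show ?thesis by blast
  next
    case (insr c0 ws f v us M)
    have rep: "f = (\<lambda>v. b (Off v))" "path_list b m = us @ (M @ [v]) @ ws" "length us = p"
        "p + length (M @ [v]) = Suc q"
      using assms(2) c insr(1) by auto
    have split: "path_list b m = (us @ M) @ v # ws" using rep(2) by simp
    have lq: "length (us @ M) = q" using rep by simp
    have "class_op G A x L R c (Suc m, insert_path (Suc q) c0 b, p, Suc q)"
      unfolding c using insr(3,4) rep(1) lq path_list_split_nth[OF split] right_sum_eq[OF split]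
      by (intro class_op.insert_right) auto
    moreover have "represents (Suc m, insert_path (Suc q) c0 b, p, Suc q) C'"
      unfolding insr(2) using rep path_list_insert[of b m "us @ M @ [v]" ws c0] by auto
    ultimately show ?thesis by blast
  next
    case (lend c0 f us d v M ws)
    have rep: "f = (\<lambda>v. b (Off v))" "path_list b m = us @ (v # d # M) @ ws" "length us = p"
        "p + length (v # d # M) = Suc q"
      using assms(2) c lend(1) by auto
    have split: "path_list b m = us @ v # (d # M @ ws)" using rep(2) by simp
    have split': "path_list b m = (us @ [v]) @ d # (M @ ws)" using rep(2) by simp
    have d: "b (Path (p + 1)) = d" using path_list_split_nth[OF split'] rep by simp
    have "class_op G A x L R c (m, b(Path p := c0), if c0 \<ge> b (Path (p + 1)) then p + 1 else p, q)"
      unfolding c using lend(3,4) rep path_list_split_nth[OF split] reflected_value_Path[OF split]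
      by (intro class_op.left_endpoint) auto
    moreover have "represents (m, b(Path p := c0), if c0 \<ge> b (Path (p + 1)) then p + 1 else p, q) C'"
      unfolding lend(2) d using lend(5) rep path_list_split_upd[OF split, of c0] by auto
    ultimately show ?thesis by blast
  next
    case (lend' c0 f us d v M ws)
    have rep: "f = (\<lambda>v. b (Off v))" "path_list b m = us @ (v # d # M) @ ws" "length us = p"
        "p + length (v # d # M) = Suc q"
      using assms(2) c lend'(1) by auto
    have split: "path_list b m = us @ v # (d # M @ ws)" using rep(2) by simp
    have split': "path_list b m = (us @ [v]) @ d # (M @ ws)" using rep(2) by simp
    have d: "b (Path (p + 1)) = d" using path_list_split_nth[OF split'] rep by simp
    have "class_op G A x L R c (m, b(Path p := c0), if c0 \<ge> b (Path (p + 1)) then p + 1 else p, q)"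
      unfolding c using lend'(3,4) rep path_list_split_nth[OF split] reflected_value_Path[OF split]
      by (intro class_op.left_endpoint) auto
    moreover have "represents (m, b(Path p := c0), if c0 \<ge> b (Path (p + 1)) then p + 1 else p, q) C'"
      unfolding lend'(2) d using lend'(5) rep path_list_split_upd[OF split, of c0] by auto
    ultimately show ?thesis by blast
  next
    case (rend c0 a ws f v us M)
    have rep: "f = (\<lambda>v. b (Off v))" "path_list b m = us @ (M @ [a, v]) @ ws" "length us = p"
        "p + length (M @ [a, v]) = Suc q"
      using assms(2) c rend(1) by auto
    have split: "path_list b m = (us @ M @ [a]) @ v # ws" using rep(2) by simp
    have split': "path_list b m = (us @ M) @ a # (v # ws)" using rep(2) by simp
    have lq: "length (us @ M @ [a]) = q" "length (us @ M) = q - 1" using rep by auto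
    have a: "b (Path (q - 1)) = a" using path_list_split_nth[OF split'] lq by simp
    have "class_op G A x L R c (m, b(Path q := c0), p, if c0 \<ge> b (Path (q - 1)) then q - 1 else q)"
      unfolding c using rend(3,4) rep lq path_list_split_nth[OF split] reflected_value_Path[OF split]
      by (intro class_op.right_endpoint) auto
    moreover have "represents (m, b(Path q := c0), p, if c0 \<ge> b (Path (q - 1)) then q - 1 else q) C'"
      unfolding rend(2) a using rend(5) rep path_list_split_upd[OF split, of c0] lq by auto
    ultimately show ?thesis by blast
  next
    case (rend' c0 a ws f v us M)
    have rep: "f = (\<lambda>v. b (Off v))" "path_list b m = us @ (M @ [a, v]) @ ws" "length us = p"
        "p + length (M @ [a, v]) = Suc q"
      using assms(2) c rend'(1) by auto
    have split: "path_list b m = (us @ M @ [a]) @ v # ws" using rep(2) by simp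
    have split': "path_list b m = (us @ M) @ a # (v # ws)" using rep(2) by simp
    have lq: "length (us @ M @ [a]) = q" "length (us @ M) = q - 1" using rep by auto
    have a: "b (Path (q - 1)) = a" using path_list_split_nth[OF split'] lq by simp
    have "class_op G A x L R c (m, b(Path q := c0), p, if c0 \<ge> b (Path (q - 1)) then q - 1 else q)"
      unfolding c using rend'(3,4) rep lq path_list_split_nth[OF split] reflected_value_Path[OF split]
      by (intro class_op.right_endpoint) auto
    moreover have "represents (m, b(Path q := c0), p, if c0 \<ge> b (Path (q - 1)) then q - 1 else q) C'"
      unfolding rend'(2) a using rend'(5) rep path_list_split_upd[OF split, of c0] lq by auto
    ultimately show ?thesis by blast
  qed
qed

subsection \<open>The lower interval\<close>

context
  fixes \<alpha> :: "'v \<Rightarrow> int"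
  assumes pos: "\<alpha> \<in> pos_roots G A"
begin

abbreviation "P \<equiv> class_graph G A x L R \<alpha>"

definition \<alpha>_off :: "'v \<Rightarrow> int" where
  "\<alpha>_off = (\<lambda>v. if v = x then 0 else \<alpha> v)"

lemma represents_start: "represents (0, st_fun x 0 \<alpha>, 0, 0) (\<alpha>_off, [], [\<alpha> x], [])"
  by (auto simp: \<alpha>_off_def path_list_def)

lemma \<alpha>_nonneg: "0 \<le> \<alpha> v"
  using pos pos_roots_iff by blast

text \<open>The counts serve the existence of \<open>n\<^sub>0\<close>, and reachability is one of
  the two inclusions. Reachability is stated for all lengths at once because insertions change
  \<open>m\<close>.\<close>

lemma class_graph_invariant:
  assumes "c \<in> P"
  shows "\<exists>C. represents c C \<and> counts_bounded (sum \<alpha>_off offs) C \<and> nonneg_marked G x L R c \<and>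
    (\<forall>s\<in>elems C. list_step\<^sup>*\<^sup>* (\<alpha>_off, replicate (length (snd s)) (\<alpha> x)) s)"
  using assms
proof (induction)
  case start
  have "counts_bounded (sum \<alpha>_off offs) (\<alpha>_off, [], [\<alpha> x], [])" by simp
  moreover have "nonneg_marked G x L R (0, st_fun x 0 \<alpha>, 0, 0)"
    using \<alpha>_nonneg by (auto simp: verts_st)
  moreover have "\<forall>s\<in>elems (\<alpha>_off, [], [\<alpha> x], []). list_step\<^sup>*\<^sup>* (\<alpha>_off, replicate (length (snd s)) (\<alpha> x)) s"
    by (auto simp: stretched_singleton_iff)
  ultimately show ?case using represents_start by blast
next
  case (step c c')
  then obtain C where C: "represents c C" "counts_bounded (sum \<alpha>_off offs) C"
      "\<forall>s\<in>elems C. list_step\<^sup>*\<^sup>* (\<alpha>_off, replicate (length (snd s)) (\<alpha> x)) s" by blast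
  obtain C' where C': "represents c' C'" "list_op C C'" using class_op_imp_list_op step(2) C(1) by blast
  obtain f us M ws where C'_eq: "C' = (f, us, M, ws)" by (cases C')
  have "counts_bounded (sum \<alpha>_off offs) C'"
    using list_op_counts_bounded[OF C'(2) C(2) represents_nonempty[OF C(1)]] finite_verts by simp
  moreover have "list_step\<^sup>*\<^sup>* (\<alpha>_off, replicate (length (snd s')) (\<alpha> x)) s'" if s': "s' \<in> elems C'" for s'
  proof -
    have nn: "\<forall>v\<in>offs. 0 \<le> f v" "\<forall>a\<in>set (us @ M @ ws). 0 \<le> a"
      using nonneg_marked_iff C'(1) step(3) C'_eq by blast+
    obtain ys where "s' = (f, us @ ys @ ws)" "stretched M ys" using s' C'_eq by auto
    then have "\<forall>v\<in>offs. 0 \<le> fst s' v" "\<forall>a\<in>set (snd s'). 0 \<le> a"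
      using nn stretched_set by fastforce+
    then obtain s where "s \<in> elems C" "length (snd s) = length (snd s')" "list_step\<^sup>*\<^sup>* s s'"
      using elems_reachable[OF C'(2) represents_nonempty[OF C(1)] s'] by blast
    then show ?thesis using C(3) by (metis rtranclp_trans)
  qed
  ultimately show ?case using C'(1) step(3) by blast
qed

text \<open>The path for \<open>n\<close> has \<open>Suc n\<close> vertices. One is kept for the
  mark, so \<open>n\<close> has to bound the number of unmarked ones.\<close>

lemma singles_defined_on_large: "singles_defined_on P (nat (2 + 4 * sum \<alpha>_off offs))"
  unfolding singles_defined_on_def
proof (intro ballI impI)
  fix c assume c: "c \<in> P" "single_asterisk c"
  obtain C where C: "represents c C" "counts_bounded (sum \<alpha>_off offs) C" "nonneg_marked G x L R c"
    using class_graph_invariant c(1) by blast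
  obtain f us M ws where C_eq: "C = (f, us, M, ws)" by (cases C)
  have "length M = 1" using C(1) c(2) C_eq by (cases c) auto
  then obtain v where M: "M = [v]" by (auto simp: length_Suc_conv)
  have "0 \<le> sum f offs" using nonneg_marked_iff C(1,3) C_eq by (auto intro: sum_nonneg)
  then have "int (length us + length ws) \<le> 2 + 4 * sum \<alpha>_off offs"
    using counts_bounded_single C(2) unfolding C_eq M by blast
  then have b: "length us + length ws \<le> nat (2 + 4 * sum \<alpha>_off offs)" (is "_ \<le> ?n") by linarith
  then have "length M \<le> Suc ?n - length us - length ws" using M by simp
  then obtain ys where "stretched M ys" "length ys = Suc ?n - length us - length ws"
    using stretched_extend[of M "Suc ?n - length us - length ws"] M by blast
  then have "(f, us @ ys @ ws) \<in> {s \<in> elems C. length (snd s) = Suc ?n}"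
    using b C_eq by auto
  then show "stretching_class c ?n \<noteq> {}" using stretching_class_eq[OF C(1)] by blast
qed

lemma single_asterisk_length:
  assumes "represents c (f, us, M, ws)" "length M = 1" "stretching_class c n \<noteq> {}"
  shows "length (us @ M @ ws) \<le> Suc n"
proof -
  obtain ys where "stretched M ys" "length (us @ ys @ ws) = Suc n"
    using assms(3) stretching_class_eq[OF assms(1)] by auto
  then show ?thesis using stretched_length[of M ys] by simp
qed

lemma list_steps_in_class:
  assumes "singles_defined_on P n\<^sub>0" "n \<ge> n\<^sub>0 + 1"
    and "list_step\<^sup>*\<^sup>* (\<alpha>_off, replicate (Suc n) (\<alpha> x)) s"
  shows "\<exists>c\<in>P. \<exists>C. represents c C \<and> s \<in> elems C \<and> length (snd s) = Suc n"
  using assms(3)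
proof (induction)
  case base
  have "(\<alpha>_off, [] @ replicate (Suc n) (\<alpha> x) @ []) \<in> elems (\<alpha>_off, [], [\<alpha> x], [])"
    by (rule elemsI) (auto simp: stretched_singleton_iff simp del: replicate_Suc)
  then have "(\<alpha>_off, replicate (Suc n) (\<alpha> x)) \<in> elems (\<alpha>_off, [], [\<alpha> x], [])" by simp
  moreover have "length (snd (\<alpha>_off, replicate (Suc n) (\<alpha> x))) = Suc n" by simp
  ultimately show ?case
    using represents_start by (intro bexI[OF _ class_graph.start] exI conjI)
next
  case (step s s')
  then obtain c C where c: "c \<in> P" "represents c C" "s \<in> elems C" "length (snd s) = Suc n" by blast
  obtain f us M ws where C: "C = (f, us, M, ws)" by (cases C)
  have M: "M \<noteq> []" using represents_nonempty c(2) C by fastforce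
  \<comment> \<open>The list with each marked value taken once has at most
    \<open>Suc n\<^sub>0\<close> entries, but \<open>s\<close> has at least one more. Hence a sole
    marked value is repeated in \<open>s\<close>.\<close>
  have "length (us @ M @ ws) < length (snd s)" if "length M = 1"
  proof -
    have "single_asterisk c" using c(2) C that by (cases c) auto
    then have "length (us @ M @ ws) \<le> Suc n\<^sub>0"
      using single_asterisk_length c(1,2) C that assms(1) unfolding singles_defined_on_def by blast
    then show ?thesis using assms(2) c(4) by simp
  qed
  then obtain C' where C': "C' = C \<or> list_op C C'" "s' \<in> elems C'"
    using elems_list_step[OF step(2) c(3) C M] by blast
  have len: "length (snd s') = Suc n" using list_step_length step(2) c(4) by simp
  show ?case
  proof (cases "C' = C")
    case True
    then show ?thesis using c C' len by blast
  next
    case False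
    then obtain c' where c': "class_op G A x L R c c'" "represents c' C'"
      using C' list_op_imp_class_op c(2) by blast
    obtain f' us' M' ws' where C'_eq: "C' = (f', us', M', ws')" by (cases C')
    have nn: "(\<forall>v\<in>offs. 0 \<le> f v) \<and> (\<forall>a\<in>set (us @ M @ ws). 0 \<le> a)"
      using class_graph_invariant[OF c(1)] nonneg_marked_iff c(2) C by blast
    obtain ys where "s = (f, us @ ys @ ws)" "stretched M ys" using c(3) C by auto
    then have nns: "(\<forall>v\<in>offs. 0 \<le> fst s v) \<and> (\<forall>a\<in>set (snd s). 0 \<le> a)"
      using nn stretched_set by fastforce
    \<comment> \<open>A descent keeps all values nonnegative, and every entry of \<open>M'\<close>
      occurs in \<open>s'\<close>; so the result of the operation is not discarded.\<close>
    have "(\<forall>v\<in>offs. 0 \<le> fst s' v) \<and> (\<forall>a\<in>set (snd s'). 0 \<le> a)"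
      using step(2) nns by (cases rule: list_step.cases) auto
    moreover obtain ys' where "s' = (f', us' @ ys' @ ws')" "stretched M' ys'" using C'(2) C'_eq by auto
    ultimately have "(\<forall>v\<in>offs. 0 \<le> f' v) \<and> (\<forall>a\<in>set (us' @ M' @ ws'). 0 \<le> a)"
      using stretched_set[of M' ys'] by auto
    then have "nonneg_marked G x L R c'"
      using nonneg_marked_iff[OF c'(2)[unfolded C'_eq]] by blast
    then have "c' \<in> P" by (rule class_graph.step[OF c(1) c'(1)])
    then show ?thesis using c'(2) C'(2) len by blast
  qed
qed

lemma st_fun_pos_root: "st_fun x n \<alpha> \<in> pos_roots (stG n) (stA n)"
proof -
  have "0 \<le> st_fun x n \<alpha> z" for z using \<alpha>_nonneg by (cases z) auto
  then show ?thesis using st_fun_root pos by (simp add: pos_roots_def)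
qed

lemma lower_interval_eq:
  assumes "singles_defined_on P n\<^sub>0" "n \<ge> n\<^sub>0 + 1"
  shows "{\<beta> \<in> pos_roots (stG n) (stA n). root_le (stG n) (stA n) \<beta> (st_fun x n \<alpha>)} =
    (\<Union>c\<in>P. stretching_class c n)"
proof -
  interpret S: cartan "stG n" "stA n" by (rule st_cartan)
  let ?s = "(\<alpha>_off, replicate (Suc n) (\<alpha> x))"
  have "{\<beta> \<in> pos_roots (stG n) (stA n). root_le (stG n) (stA n) \<beta> (st_fun x n \<alpha>)} =
      {\<beta>. S.descent\<^sup>*\<^sup>* (st_fun x n \<alpha>) \<beta>}"
    using S.root_le_iff[OF st_fun_pos_root] by (auto simp: root_le_def)
  also have "\<dots> = {of_lists s | s. list_step\<^sup>*\<^sup>* ?s s}"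
    using descents_iff_list_steps[of ?s n] by (auto simp: st_fun_eq \<alpha>_off_def simp del: replicate_Suc)
  also have "\<dots> = (\<Union>c\<in>P. stretching_class c n)"
  proof (intro equalityI subsetI)
    fix g assume "g \<in> {of_lists s | s. list_step\<^sup>*\<^sup>* ?s s}"
    then obtain s where s: "g = of_lists s" "list_step\<^sup>*\<^sup>* ?s s" by blast
    then obtain c C where c: "c \<in> P" "represents c C" "s \<in> elems C" "length (snd s) = Suc n"
      using list_steps_in_class[OF assms s(2)] by blast
    then have "g \<in> stretching_class c n" unfolding stretching_class_eq[OF c(2)] s(1) by blast
    then show "g \<in> (\<Union>c\<in>P. stretching_class c n)" using c(1) by blast
  next
    fix g assume "g \<in> (\<Union>c\<in>P. stretching_class c n)"
    then obtain c where c: "c \<in> P" "g \<in> stretching_class c n" by blast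
    then obtain C where C: "represents c C" "\<forall>s\<in>elems C. list_step\<^sup>*\<^sup>* (\<alpha>_off, replicate (length (snd s)) (\<alpha> x)) s"
      using class_graph_invariant by blast
    then obtain s where "s \<in> elems C" "length (snd s) = Suc n" "g = of_lists s"
      using c(2) unfolding stretching_class_eq[OF C(1)] by blast
    then show "g \<in> {of_lists s | s. list_step\<^sup>*\<^sup>* ?s s}" using C(2) by (metis (mono_tags) mem_Collect_eq)
  qed
  finally show ?thesis .
qed

lemma minimal_singles_defined_on:
  "\<exists>n\<^sub>0. singles_defined_on P n\<^sub>0 \<and> (\<forall>k. singles_defined_on P k \<longrightarrow> n\<^sub>0 \<le> k)"
  using singles_defined_on_large by (meson LeastI Least_le)

end

end

theorem theorem3p4:
  fixes G :: "'v diagram" and A :: "'v \<Rightarrow> 'v \<Rightarrow> int"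
    and x :: 'v and L R :: "'v set" and \<alpha> :: "'v \<Rightarrow> int"
  assumes "coxeter_diagram G"
    and "crystallographic_cartan G A"
    and "elastic_data G x L R"
    and "\<alpha> \<in> pos_roots G A"
  shows "\<exists>n\<^sub>0. singles_defined_on (class_graph G A x L R \<alpha>) n\<^sub>0 \<and>
    (\<forall>k. singles_defined_on (class_graph G A x L R \<alpha>) k \<longrightarrow> n\<^sub>0 \<le> k) \<and>
    (\<forall>n\<ge>n\<^sub>0 + 1.
      {\<beta> \<in> pos_roots (st_diagram G x L R n) (st_cartan A x L R n).
         root_le (st_diagram G x L R n) (st_cartan A x L R n) \<beta> (st_fun x n \<alpha>)} =
      (\<Union>c\<in>class_graph G A x L R \<alpha>. stretching_class c n))"
proof -
  interpret stretching G A x L R using assms(1-3) by unfold_locales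
  show ?thesis
    using minimal_singles_defined_on[OF assms(4)] lower_interval_eq[OF assms(4)] by blast
qed

end
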